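(* Let $K\ge 1$, $K'\ge 0$ and $p\in(1,\infty)$. There are constants $C_1(K,p)$ and $C_2(K,p)$, depending only on $K$ and $p$, such that the following holds. Let $f=u+iv$ be a harmonic $(K,K')$-quasiregular mapping in $\mathbb{D}$ with $v(0)=0$ (where $u=\mathrm{Re}\, f$, $v=\mathrm{Im}\, f$). If $u\in\mathbf{h}^{p}$, then $v\in\mathbf{h}^{p}$, and for all $r\in[0,1)$ $$M_{p}(r,v)\le C_{1}(K,p)\,M_{p}(r,u)+C_{2}(K,p)\sqrt{K'}.$$
   Context: $\mathbb{D}$ is the open unit disk in $\mathbb{C}$. For a complex-valued $f$ write $f_z=\frac12(f_x-if_y)$, $f_{\overline z}=\frac12(f_x+if_y)$, $\Lambda_f=|f_z|+|f_{\overline z}|$, and $J_f=|f_z|^2-|f_{\overline z}|^2$ (the Jacobian). For constants $K\ge1$, $K'\ge0$, a mapping $f:\mathbb{D}\to\mathbb{C}$ is $(K,K')$-quasiregular if (1) $f$ is absolutely continuous on lines with locally $L^2$-integrable partial derivatives ($ACL^2$) and $J_f\ge0$ a.e. in $\mathbb{D}$; and (2) $\Lambda_f^2\le KJ_f+K'$ a.e. in $\mathbb{D}$. A harmonic $(K,K')$-quasiregular mapping is a complex-valued harmonic function on $\mathbb{D}$ that is $(K,K')$-quasiregular. For $p\in(0,\infty)$ and $r\in[0,1)$, $M_p(r,f)=\left(\frac1{2\pi}\int_0^{2\pi}|f(re^{i\theta})|^p\,d\theta\right)^{1/p}$. $\mathbf{h}^p$ is the set of all harmonic (complex-valued) functions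 $f$ on $\mathbb{D}$ with $\|f\|_p=\sup_{r\in[0,1)}M_p(r,f)<\infty$. *)

theory Defs
  imports "HOL-Analysis.Analysis"
begin

section \<open>Partial derivatives and Wirtinger derivatives\<close>

definition partial_x :: "(complex \<Rightarrow> complex) \<Rightarrow> complex \<Rightarrow> complex" where
  "partial_x f z = vector_derivative (\<lambda>t::real. f (z + of_real t)) (at 0)"

definition partial_y :: "(complex \<Rightarrow> complex) \<Rightarrow> complex \<Rightarrow> complex" where
  "partial_y f z = vector_derivative (\<lambda>t::real. f (z + \<i> * of_real t)) (at 0)"

definition wirtinger :: "(complex \<Rightarrow> complex) \<Rightarrow> complex \<Rightarrow> complex" where
  "wirtinger f z = (partial_x f z - \<i> * partial_y f z) / 2"

definition wirtinger_bar :: "(complex \<Rightarrow> complex) \<Rightarrow> complex \<Rightarrow> complex" where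
  "wirtinger_bar f z = (partial_x f z + \<i> * partial_y f z) / 2"

definition Lambda :: "(complex \<Rightarrow> complex) \<Rightarrow> complex \<Rightarrow> real" where
  "Lambda f z = cmod (wirtinger f z) + cmod (wirtinger_bar f z)"

definition Jac :: "(complex \<Rightarrow> complex) \<Rightarrow> complex \<Rightarrow> real" where
  "Jac f z = (cmod (wirtinger f z))\<^sup>2 - (cmod (wirtinger_bar f z))\<^sup>2"


section \<open>Harmonic functions\<close>

text \<open>\<open>vector_derivative\<close> takes an unspecified value where the derivative does not exist, so
  existence of the partial derivatives is required separately.\<close>

definition C1_on :: "complex set \<Rightarrow> (complex \<Rightarrow> complex) \<Rightarrow> bool" where
  "C1_on S f \<longleftrightarrow>
     (\<forall>z\<in>S. (\<lambda>t::real. f (z + of_real t)) differentiable (at 0)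
          \<and> (\<lambda>t::real. f (z + \<i> * of_real t)) differentiable (at 0))
     \<and> continuous_on S (partial_x f) \<and> continuous_on S (partial_y f)"

definition C2_on :: "complex set \<Rightarrow> (complex \<Rightarrow> complex) \<Rightarrow> bool" where
  "C2_on S f \<longleftrightarrow> C1_on S f \<and> C1_on S (partial_x f) \<and> C1_on S (partial_y f)"

definition complex_harmonic_on :: "complex set \<Rightarrow> (complex \<Rightarrow> complex) \<Rightarrow> bool" where
  "complex_harmonic_on S f \<longleftrightarrow> open S \<and> C2_on S f
     \<and> (\<forall>z\<in>S. partial_x (partial_x f) z + partial_y (partial_y f) z = 0)"


section \<open>Absolute continuity on lines\<close>

text \<open>A pair \<open>(x, y)\<close> in \<open>P\<close> stands for the open interval \<open>{x<..<y}\<close>; these intervals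
  are pairwise disjoint and their closures may touch.\<close>

definition abs_continuous_on_interval :: "real \<Rightarrow> real \<Rightarrow> (real \<Rightarrow> complex) \<Rightarrow> bool" where
  "abs_continuous_on_interval a b g \<longleftrightarrow>
     (\<forall>\<epsilon>>0. \<exists>\<delta>>0. \<forall>P. finite P
        \<and> (\<forall>(x, y)\<in>P. a \<le> x \<and> x \<le> y \<and> y \<le> b)
        \<and> pairwise (\<lambda>(x, y) (x', y'). {x<..<y} \<inter> {x'<..<y'} = {}) P
        \<and> (\<Sum>(x, y)\<in>P. y - x) < \<delta>
        \<longrightarrow> (\<Sum>(x, y)\<in>P. cmod (g y - g x)) < \<epsilon>)"

text \<open>ACL: continuous, and in every closed rectangle contained in the domain absolutely continuous
  on almost every horizontal and almost every vertical segment.\<close>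

definition ACL_on :: "complex set \<Rightarrow> (complex \<Rightarrow> complex) \<Rightarrow> bool" where
  "ACL_on S f \<longleftrightarrow> continuous_on S f
     \<and> (\<forall>a b. cbox a b \<subseteq> S \<longrightarrow>
          (AE y in lborel. y \<in> {Im a..Im b} \<longrightarrow>
             abs_continuous_on_interval (Re a) (Re b) (\<lambda>x. f (Complex x y)))
        \<and> (AE x in lborel. x \<in> {Re a..Re b} \<longrightarrow>
             abs_continuous_on_interval (Im a) (Im b) (\<lambda>y. f (Complex x y))))"

definition locally_L2_on :: "complex set \<Rightarrow> (complex \<Rightarrow> complex) \<Rightarrow> bool" where
  "locally_L2_on S g \<longleftrightarrow>
     (\<forall>C. compact C \<and> C \<subseteq> S \<longrightarrow>
        g \<in> borel_measurable (lebesgue_on C)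
        \<and> integrable (lebesgue_on C) (\<lambda>z. (cmod (g z))\<^sup>2))"

definition ACL2_on :: "complex set \<Rightarrow> (complex \<Rightarrow> complex) \<Rightarrow> bool" where
  "ACL2_on S f \<longleftrightarrow>
     ACL_on S f \<and> locally_L2_on S (partial_x f) \<and> locally_L2_on S (partial_y f)"


section \<open>Quasiregular mappings and harmonic Hardy spaces of the unit disk\<close>

abbreviation unit_disk :: "complex set" where
  "unit_disk \<equiv> ball 0 1"

definition quasiregular :: "real \<Rightarrow> real \<Rightarrow> (complex \<Rightarrow> complex) \<Rightarrow> bool" where
  "quasiregular K K' f \<longleftrightarrow>
     ACL2_on unit_disk f
     \<and> (AE z in lebesgue. z \<in> unit_disk \<longrightarrow> 0 \<le> Jac f z)
     \<and> (AE z in lebesgue. z \<in> unit_disk \<longrightarrow> (Lambda f z)\<^sup>2 \<le> K * Jac f z + K')"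

definition harmonic_quasiregular :: "real \<Rightarrow> real \<Rightarrow> (complex \<Rightarrow> complex) \<Rightarrow> bool" where
  "harmonic_quasiregular K K' f \<longleftrightarrow> complex_harmonic_on unit_disk f \<and> quasiregular K K' f"

definition integral_mean :: "real \<Rightarrow> real \<Rightarrow> (complex \<Rightarrow> complex) \<Rightarrow> real" where
  "integral_mean p r f =
     (1 / (2 * pi) * integral {0..2 * pi} (\<lambda>t. cmod (f (of_real r * cis t)) powr p)) powr (1 / p)"

definition harmonic_hardy :: "real \<Rightarrow> (complex \<Rightarrow> complex) set" where
  "harmonic_hardy p =
     {f. complex_harmonic_on unit_disk f \<and> bdd_above ((\<lambda>r. integral_mean p r f) ` {0..<1})}"

end

theory Submission
  imports Defs
begin

text \<open>
  Write \<open>q = p / 2\<close>. Quasiregularity gives \<open>|grad v|\<^sup>2 \<le> 4 K\<^sup>2 |grad u|\<^sup>2 + 4 K'\<close> everywhere. With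
  \<open>k > K'\<close> and \<open>S = u\<^sup>2 + k (1 + |z|\<^sup>2)\<close>, i.e. replacing \<open>u\<close> by the harmonic vector
  \<open>(u, \<surd>k x, \<surd>k y, \<surd>k)\<close>, the additive constant is absorbed into the gradient of that vector
  and \<open>S\<close> becomes smooth and positive. If \<open>p \<ge> 2\<close>, then \<open>\<Psi> = (v\<^sup>2 + \<beta> S)\<^sup>q - 2 (v\<^sup>2 + S)\<^sup>q\<close> is
  subharmonic for a large constant \<open>\<beta>\<close>; if \<open>p < 2\<close>, then \<open>\<Psi> = M S\<^sup>q - (v\<^sup>2 + S)\<^sup>q\<close> is subharmonic
  for a large constant \<open>M\<close>. In both cases \<open>\<Psi>(0) \<ge> 0\<close> because \<open>v(0) = 0\<close>, and \<open>\<Psi>\<close> is at most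
  \<open>C S\<^sup>q - c |v|\<^sup>p\<close>, so the mean value inequality bounds the mean of \<open>|v|\<^sup>p\<close> by that of \<open>S\<^sup>q\<close>.
  Finally \<open>k\<close> tends to \<open>K'\<close>. The mean value inequality is proved in the coordinates
  \<open>z = exp (x + iy)\<close>, where the circle mean of a subharmonic function is a convex function of \<open>x\<close>
  that stays bounded as \<open>x\<close> tends to minus infinity, hence nondecreasing.
\<close>

section \<open>Logarithmic polar coordinates\<close>

text \<open>Continuous partial derivatives give a total derivative. On a product of intervals around
  \<open>z\<close> it suffices that the x-derivative exists at \<open>z\<close> and that the
  y-derivative exists nearby and is continuous at \<open>z\<close>.\<close>

lemma C1_on_has_derivative:
  assumes C1: "C1_on S f" and "open S" "z \<in> S"
  shows "(f has_derivative (\<lambda>h. Re h *\<^sub>R partial_x f z + Im h *\<^sub>R partial_y f z)) (at z)"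
proof -
  obtain a b where ab: "z \<in> box a b" "box a b \<subseteq> S"
    using open_contains_box[OF \<open>open S\<close> \<open>z \<in> S\<close>] by blast
  define X where "X = {Re a<..<Re b}"
  define Y where "Y = {Im a<..<Im b}"
  have XY: "Complex x y \<in> S" if "x \<in> X" "y \<in> Y" for x y
    using ab(2) that by (auto simp: X_def Y_def in_box_complex_iff subset_iff)
  have zXY: "Re z \<in> X" "Im z \<in> Y"
    using ab(1) by (auto simp: X_def Y_def in_box_complex_iff)
  have dx: "((\<lambda>t. f (Complex t y)) has_vector_derivative partial_x f (Complex x y)) (at x)"
    if "Complex x y \<in> S" for x y
  proof -
    have shift: "Complex x y + of_real (t - x) = Complex t y" for t
      by (simp add: complex_eq_iff)
    have "((\<lambda>t::real. f (Complex x y + of_real t)) has_vector_derivative partial_x f (Complex x y)) (at (x - x))"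
      using C1 that unfolding C1_on_def partial_x_def by (auto simp: vector_derivative_works)
    moreover have "((\<lambda>t. t - x) has_vector_derivative 1) (at x)"
      by (auto intro!: derivative_eq_intros)
    ultimately have "((\<lambda>t::real. f (Complex x y + of_real t)) \<circ> (\<lambda>t. t - x)
        has_vector_derivative 1 *\<^sub>R partial_x f (Complex x y)) (at x)"
      by (rule vector_diff_chain_at[rotated])
    moreover have "(\<lambda>t::real. f (Complex x y + of_real t)) \<circ> (\<lambda>t. t - x) = (\<lambda>t. f (Complex t y))"
      by (simp add: o_def shift del: of_real_diff)
    ultimately show ?thesis by simp
  qed
  have dy: "((\<lambda>t. f (Complex x t)) has_vector_derivative partial_y f (Complex x y)) (at y)"
    if "Complex x y \<in> S" for x y
  proof -
    have shift: "Complex x y + \<i> * of_real (t - y) = Complex x t" for t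
      by (simp add: complex_eq_iff)
    have "((\<lambda>t::real. f (Complex x y + \<i> * of_real t)) has_vector_derivative partial_y f (Complex x y)) (at (y - y))"
      using C1 that unfolding C1_on_def partial_y_def by (auto simp: vector_derivative_works)
    moreover have "((\<lambda>t. t - y) has_vector_derivative 1) (at y)"
      by (auto intro!: derivative_eq_intros)
    ultimately have "((\<lambda>t::real. f (Complex x y + \<i> * of_real t)) \<circ> (\<lambda>t. t - y)
        has_vector_derivative 1 *\<^sub>R partial_y f (Complex x y)) (at y)"
      by (rule vector_diff_chain_at[rotated])
    moreover have "(\<lambda>t::real. f (Complex x y + \<i> * of_real t)) \<circ> (\<lambda>t. t - y) = (\<lambda>t. f (Complex x t))"
      by (simp add: o_def shift del: of_real_diff)
    ultimately show ?thesis by simp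
  qed
  have "continuous_on (X \<times> Y) (\<lambda>w. partial_y f (Complex (fst w) (snd w)))"
  proof (rule continuous_on_compose2[of S "partial_y f"])
    show "continuous_on S (partial_y f)" using C1 by (simp add: C1_on_def)
    show "continuous_on (X \<times> Y) (\<lambda>w. Complex (fst w) (snd w))"
      unfolding Complex_eq by (intro continuous_intros)
  qed (use XY in auto)
  then have "continuous_on (X \<times> Y) (\<lambda>(x, y). blinfun_scaleR_left (partial_y f (Complex x y)))"
    unfolding case_prod_unfold by (intro continuous_intros)
  then have cont: "continuous (at (Re z, Im z) within X \<times> Y)
      (\<lambda>(x, y). blinfun_scaleR_left (partial_y f (Complex x y)))"
    using zXY by (simp add: continuous_on_eq_continuous_within)
  have "((\<lambda>(x, y). f (Complex x y)) has_derivative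
      (\<lambda>(tx, ty). tx *\<^sub>R partial_x f z + blinfun_apply (blinfun_scaleR_left (partial_y f (Complex (Re z) (Im z)))) ty))
      (at (Re z, Im z) within X \<times> Y)"
  proof (rule has_derivative_partialsI[OF _ _ cont])
    show "((\<lambda>x. f (Complex x (Im z))) has_derivative (\<lambda>tx. tx *\<^sub>R partial_x f z)) (at (Re z) within X)"
      using dx[of "Re z" "Im z"] assms(3) unfolding has_vector_derivative_def
      by (auto intro: has_derivative_at_withinI)
    show "((\<lambda>y. f (Complex x y)) has_derivative blinfun_apply (blinfun_scaleR_left (partial_y f (Complex x y)))) (at y within Y)"
      if "x \<in> X" "y \<in> Y" for x y
      using dy[OF XY[OF that]] unfolding has_vector_derivative_def
      by (auto intro: has_derivative_at_withinI)
  qed (use zXY in \<open>auto simp: Y_def\<close>)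
  moreover have "at (Re z, Im z) within X \<times> Y = at (Re z, Im z)"
    using zXY by (intro at_within_open) (auto simp: X_def Y_def open_Times)
  ultimately have D: "((\<lambda>(x, y). f (Complex x y)) has_derivative
      (\<lambda>(tx, ty). tx *\<^sub>R partial_x f z + ty *\<^sub>R partial_y f z)) (at (Re z, Im z))"
    by simp
  have "((\<lambda>w. (Re w, Im w)) has_derivative (\<lambda>w. (Re w, Im w))) (at z)"
    by (auto intro!: derivative_eq_intros)
  from has_derivative_compose[OF this D] show ?thesis by simp
qed

text \<open>
  The derivatives of \<open>f (exp (x + iy))\<close> in \<open>x\<close> and \<open>y\<close>, expressed through the partial derivatives of \<open>f\<close>.
\<close>

definition log_polar_dx :: "(complex \<Rightarrow> complex) \<Rightarrow> real \<Rightarrow> real \<Rightarrow> complex" where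
  "log_polar_dx f x y = (let z = exp (Complex x y) in Re z *\<^sub>R partial_x f z + Im z *\<^sub>R partial_y f z)"

definition log_polar_dy :: "(complex \<Rightarrow> complex) \<Rightarrow> real \<Rightarrow> real \<Rightarrow> complex" where
  "log_polar_dy f x y = (let z = exp (Complex x y) in Re z *\<^sub>R partial_y f z - Im z *\<^sub>R partial_x f z)"

text \<open>The leading term comes from differentiating the coefficients \<open>Re z\<close> and
  \<open>Im z\<close> of \<open>log_polar_dx\<close>. In \<open>log_polar_dyy\<close> its
  counterpart has the opposite sign, so the two cancel in the Laplacian.\<close>

definition log_polar_dxx :: "(complex \<Rightarrow> complex) \<Rightarrow> real \<Rightarrow> real \<Rightarrow> complex" where
  "log_polar_dxx f x y = log_polar_dx f x y
     + (let z = exp (Complex x y) in Re z *\<^sub>R log_polar_dx (partial_x f) x y + Im z *\<^sub>R log_polar_dx (partial_y f) x y)"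

definition log_polar_dyy :: "(complex \<Rightarrow> complex) \<Rightarrow> real \<Rightarrow> real \<Rightarrow> complex" where
  "log_polar_dyy f x y = - log_polar_dx f x y
     + (let z = exp (Complex x y) in Re z *\<^sub>R log_polar_dy (partial_y f) x y - Im z *\<^sub>R log_polar_dy (partial_x f) x y)"

lemma exp_in_unit_disk [simp]: "exp (Complex x y) \<in> unit_disk \<longleftrightarrow> x < 0"
  by simp

lemma has_vector_derivative_exp_Complex:
  "((\<lambda>x. exp (Complex x y)) has_vector_derivative exp (Complex x y)) (at x)"
  "((\<lambda>y. exp (Complex x y)) has_vector_derivative \<i> * exp (Complex x y)) (at y)"
proof -
  have "((\<lambda>x. Complex x y) has_vector_derivative 1) (at x)"
    unfolding Complex_eq by (auto intro!: derivative_eq_intros)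
  then show "((\<lambda>x. exp (Complex x y)) has_vector_derivative exp (Complex x y)) (at x)"
    using field_vector_diff_chain_at[OF _ DERIV_exp, of "\<lambda>x. Complex x y" 1 x] by (simp add: o_def)
  have "((\<lambda>y. Complex x y) has_vector_derivative \<i>) (at y)"
    unfolding Complex_eq by (auto intro!: derivative_eq_intros)
  then show "((\<lambda>y. exp (Complex x y)) has_vector_derivative \<i> * exp (Complex x y)) (at y)"
    using field_vector_diff_chain_at[OF _ DERIV_exp, of "\<lambda>y. Complex x y" \<i> y] by (simp add: o_def)
qed

lemma C1_on_log_polar:
  assumes "C1_on unit_disk f" "x < 0"
  shows "((\<lambda>x. f (exp (Complex x y))) has_vector_derivative log_polar_dx f x y) (at x)"
    and "((\<lambda>y. f (exp (Complex x y))) has_vector_derivative log_polar_dy f x y) (at y)"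
proof -
  have D: "(f has_derivative (\<lambda>h. Re h *\<^sub>R partial_x f (exp (Complex x y)) + Im h *\<^sub>R partial_y f (exp (Complex x y))))
      (at (exp (Complex x y)))"
    using assms by (intro C1_on_has_derivative) auto
  show "((\<lambda>x. f (exp (Complex x y))) has_vector_derivative log_polar_dx f x y) (at x)"
    using has_derivative_compose[OF has_vector_derivative_exp_Complex(1)[unfolded has_vector_derivative_def] D]
    by (simp add: has_vector_derivative_def log_polar_dx_def Let_def scaleR_right_distrib)
  show "((\<lambda>y. f (exp (Complex x y))) has_vector_derivative log_polar_dy f x y) (at y)"
    using has_derivative_compose[OF has_vector_derivative_exp_Complex(2)[unfolded has_vector_derivative_def] D]
    by (simp add: has_vector_derivative_def log_polar_dy_def Let_def scaleR_right_distrib scaleR_right_diff_distrib)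
qed

lemma has_vector_derivative_Re_Im:
  assumes "(f has_vector_derivative f') F"
  shows "((\<lambda>x. Re (f x)) has_real_derivative Re f') F" "((\<lambda>x. Im (f x)) has_real_derivative Im f') F"
  using bounded_linear.has_vector_derivative[OF bounded_linear_Re assms]
    bounded_linear.has_vector_derivative[OF bounded_linear_Im assms]
  by (simp_all add: has_real_derivative_iff_has_vector_derivative)

lemma C2_on_log_polar:
  assumes "C2_on unit_disk f" "x < 0"
  shows "((\<lambda>x. log_polar_dx f x y) has_vector_derivative log_polar_dxx f x y) (at x)"
    and "((\<lambda>y. log_polar_dy f x y) has_vector_derivative log_polar_dyy f x y) (at y)"
proof -
  note D = C1_on_log_polar[of "partial_x f" x y] C1_on_log_polar[of "partial_y f" x y]
  have C: "C1_on unit_disk (partial_x f)" "C1_on unit_disk (partial_y f)"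
    using assms by (auto simp: C2_on_def)
  note E = has_vector_derivative_Re_Im[OF has_vector_derivative_exp_Complex(1)[of y x]]
    has_vector_derivative_Re_Im[OF has_vector_derivative_exp_Complex(2)[of x y]]
  show "((\<lambda>x. log_polar_dx f x y) has_vector_derivative log_polar_dxx f x y) (at x)"
    unfolding log_polar_dx_def[of f] Let_def
    by (rule has_vector_derivative_eq_rhs,
        (rule has_vector_derivative_add has_vector_derivative_scaleR D E C \<open>x < 0\<close>)+)
       (simp add: log_polar_dxx_def log_polar_dx_def[of f] Let_def del: Re_exp Im_exp)
  show "((\<lambda>y. log_polar_dy f x y) has_vector_derivative log_polar_dyy f x y) (at y)"
    unfolding log_polar_dy_def[of f] Let_def
    by (rule has_vector_derivative_eq_rhs,
        (rule has_vector_derivative_diff has_vector_derivative_scaleR D E C \<open>x < 0\<close>)+)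
       (simp add: log_polar_dyy_def log_polar_dx_def[of f] Let_def del: Re_exp Im_exp)
qed

text \<open>With \<open>z = exp (Complex x y)\<close> the sum is \<open>|z|^2\<close> times the
  Euclidean Laplacian of \<open>f\<close> at \<open>z\<close>, since each mixed derivative occurs
  once with either sign.\<close>

lemma log_polar_laplacian:
  assumes "complex_harmonic_on unit_disk f" "x < 0"
  shows "log_polar_dxx f x y + log_polar_dyy f x y = 0"
proof -
  define z where "z = exp (Complex x y)"
  have "z \<in> unit_disk" using assms(2) by (simp add: z_def del: mem_ball mem_ball_0)
  then have "partial_x (partial_x f) z = - partial_y (partial_y f) z"
    using assms(1) unfolding complex_harmonic_on_def by (simp add: eq_neg_iff_add_eq_0)
  then show ?thesis
    by (simp add: log_polar_dxx_def log_polar_dyy_def log_polar_dx_def log_polar_dy_def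
        flip: z_def) (simp add: algebra_simps)
qed

lemma log_polar_periodic: "log_polar_dy f x (y + 2 * pi) = log_polar_dy f x y"
proof -
  have "exp (Complex x (y + 2 * pi)) = exp (Complex x y)"
    by (auto simp: complex_eq_iff Re_exp Im_exp)
  then show ?thesis by (simp add: log_polar_dy_def)
qed

lemma C1_on_imp_continuous_on: "C1_on S f \<Longrightarrow> open S \<Longrightarrow> continuous_on S f"
  by (blast intro: continuous_at_imp_continuous_on has_derivative_continuous dest: C1_on_has_derivative)

lemma continuous_on_exp_Complex:
  assumes "continuous_on unit_disk g"
  shows "continuous_on ({..<0} \<times> UNIV) (\<lambda>w. g (exp (Complex (fst w) (snd w))))"
proof (rule continuous_on_compose2[OF assms])
  show "continuous_on ({..<0} \<times> UNIV) (\<lambda>w::real \<times> real. exp (Complex (fst w) (snd w)))"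
    unfolding Complex_eq by (intro continuous_intros)
qed auto

lemma continuous_on_log_polar:
  assumes "C1_on unit_disk f"
  shows "continuous_on ({..<0} \<times> UNIV) (\<lambda>w. f (exp (Complex (fst w) (snd w))))"
    and "continuous_on ({..<0} \<times> UNIV) (\<lambda>w. log_polar_dx f (fst w) (snd w))"
proof -
  have C: "continuous_on unit_disk f" "continuous_on unit_disk (partial_x f)" "continuous_on unit_disk (partial_y f)"
    using assms C1_on_imp_continuous_on[OF assms] by (auto simp: C1_on_def)
  note * = C[THEN continuous_on_exp_Complex]
  show "continuous_on ({..<0} \<times> UNIV) (\<lambda>w. f (exp (Complex (fst w) (snd w))))" by fact
  show "continuous_on ({..<0} \<times> UNIV) (\<lambda>w. log_polar_dx f (fst w) (snd w))"
    unfolding log_polar_dx_def Let_def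
    by (intro continuous_intros * continuous_on_exp_Complex[OF continuous_on_id])
qed

lemma continuous_on_log_polar_dxx:
  assumes "C2_on unit_disk f"
  shows "continuous_on ({..<0} \<times> UNIV) (\<lambda>w. log_polar_dxx f (fst w) (snd w))"
proof -
  have C: "C1_on unit_disk f" "C1_on unit_disk (partial_x f)" "C1_on unit_disk (partial_y f)"
    using assms by (auto simp: C2_on_def)
  show ?thesis
    unfolding log_polar_dxx_def Let_def
    by (intro continuous_intros C[THEN continuous_on_log_polar(2)] continuous_on_exp_Complex[OF continuous_on_id])
qed

text \<open>\<open>exp\<close> is conformal, so squared gradients scale by
  \<open>|z|^2 = exp (2 * x)\<close>. The common factor makes the gradient hypothesis on the disk
  carry over to the strip.\<close>

lemma norm_log_polar_gradient:
  "(Re (log_polar_dx f x y))\<^sup>2 + (Re (log_polar_dy f x y))\<^sup>2 =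
     exp (2 * x) * ((Re (partial_x f (exp (Complex x y))))\<^sup>2 + (Re (partial_y f (exp (Complex x y))))\<^sup>2)"
  "(Im (log_polar_dx f x y))\<^sup>2 + (Im (log_polar_dy f x y))\<^sup>2 =
     exp (2 * x) * ((Im (partial_x f (exp (Complex x y))))\<^sup>2 + (Im (partial_y f (exp (Complex x y))))\<^sup>2)"
proof -
  have *: "(a * p + b * q)\<^sup>2 + (a * q - b * p)\<^sup>2 = (a\<^sup>2 + b\<^sup>2) * (p\<^sup>2 + q\<^sup>2)" for a b p q :: real
    by algebra
  have "(Re (exp (Complex x y)))\<^sup>2 + (Im (exp (Complex x y)))\<^sup>2 = (cmod (exp (Complex x y)))\<^sup>2"
    by (simp only: cmod_power2)
  also have "\<dots> = exp (2 * x)"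
    by (simp add: exp_double)
  finally show
  "(Re (log_polar_dx f x y))\<^sup>2 + (Re (log_polar_dy f x y))\<^sup>2 =
     exp (2 * x) * ((Re (partial_x f (exp (Complex x y))))\<^sup>2 + (Re (partial_y f (exp (Complex x y))))\<^sup>2)"
  "(Im (log_polar_dx f x y))\<^sup>2 + (Im (log_polar_dy f x y))\<^sup>2 =
     exp (2 * x) * ((Im (partial_x f (exp (Complex x y))))\<^sup>2 + (Im (partial_y f (exp (Complex x y))))\<^sup>2)"
    by (simp_all add: log_polar_dx_def log_polar_dy_def Let_def * del: Re_exp Im_exp)
qed

section \<open>The mean value inequality\<close>

text \<open>The derivatives are explicit arguments, so the Laplacian is simply
  \<open>gxx + gyy\<close>. The continuity clauses serve to differentiate twice in \<open>x\<close>
  under the integral over \<open>y\<close>; the periodicity of \<open>gy\<close> makes the integral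
  of \<open>gyy\<close> over a period vanish.\<close>

definition C2_periodic_strip ::
  "(real \<Rightarrow> real \<Rightarrow> real) \<Rightarrow> (real \<Rightarrow> real \<Rightarrow> real) \<Rightarrow> (real \<Rightarrow> real \<Rightarrow> real)
     \<Rightarrow> (real \<Rightarrow> real \<Rightarrow> real) \<Rightarrow> (real \<Rightarrow> real \<Rightarrow> real) \<Rightarrow> bool" where
  "C2_periodic_strip g gx gy gxx gyy \<longleftrightarrow>
     (\<forall>x<0. \<forall>y. ((\<lambda>x. g x y) has_real_derivative gx x y) (at x)
        \<and> ((\<lambda>x. gx x y) has_real_derivative gxx x y) (at x)
        \<and> (g x has_real_derivative gy x y) (at y)
        \<and> (gy x has_real_derivative gyy x y) (at y))
     \<and> continuous_on ({..<0} \<times> UNIV) (\<lambda>w. g (fst w) (snd w))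
     \<and> continuous_on ({..<0} \<times> UNIV) (\<lambda>w. gx (fst w) (snd w))
     \<and> continuous_on ({..<0} \<times> UNIV) (\<lambda>w. gxx (fst w) (snd w))
     \<and> (\<forall>x y. gy x (y + 2 * pi) = gy x y)"

text \<open>The integral over a period is convex in \<open>x\<close>. A convex function with a
  finite limit at minus infinity has no negative slope, so it is nondecreasing and stays above that
  limit.\<close>

lemma subharmonic_strip_mean:
  assumes C2: "C2_periodic_strip g gx gy gxx gyy"
    and sub: "\<And>x y. x < 0 \<Longrightarrow> 0 \<le> gxx x y + gyy x y"
    and lim: "((\<lambda>x. integral {0..2 * pi} (g x)) \<longlongrightarrow> c) at_bot"
    and "x < 0"
  shows "c \<le> integral {0..2 * pi} (g x)"
proof -
  define m where "m x = integral {0..2 * pi} (g x)" for x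
  define m' where "m' x = integral {0..2 * pi} (gx x)" for x
  define m'' where "m'' x = integral {0..2 * pi} (gxx x)" for x
  have int: "h x integrable_on {0..2 * pi}"
    if "continuous_on ({..<0} \<times> UNIV) (\<lambda>w. h (fst w) (snd w))" "x < 0" for h :: "real \<Rightarrow> real \<Rightarrow> real" and x
    using continuous_on_compose2[OF that(1), of "{0..2 * pi}" "Pair x"] that(2)
    by (intro integrable_continuous_interval) (simp add: image_subset_iff continuous_on_Pair)
  have leibniz: "((\<lambda>x. integral {0..2 * pi} (h x)) has_real_derivative integral {0..2 * pi} (h' x)) (at x)"
    if "\<And>x y. x < 0 \<Longrightarrow> ((\<lambda>x. h x y) has_real_derivative h' x y) (at x)"
      "continuous_on ({..<0} \<times> UNIV) (\<lambda>w. h (fst w) (snd w))"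
      "continuous_on ({..<0} \<times> UNIV) (\<lambda>w. h' (fst w) (snd w))" "x < 0" for h h' x
  proof -
    have "((\<lambda>x. integral (cbox 0 (2 * pi)) (h x)) has_real_derivative integral (cbox 0 (2 * pi)) (h' x))
        (at x within {..<0})"
      using that int[OF that(2)]
      by (intro leibniz_rule_field_derivative)
         (auto simp: case_prod_unfold intro: has_field_derivative_at_within continuous_on_subset)
    then show ?thesis
      using \<open>x < 0\<close> by (simp add: at_within_open[of x "{..<0}"])
  qed
  have dm: "(m has_real_derivative m' x) (at x)" "(m' has_real_derivative m'' x) (at x)" if "x < 0" for x
    using C2 that unfolding m_def m'_def m''_def C2_periodic_strip_def
    by (auto intro!: leibniz)
  have "0 \<le> m'' x" if "x < 0" for x
  proof -
    \<comment> \<open>Since \<open>gyy\<close> integrates to zero over a period,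
      \<open>m'' x\<close> is the integral of the whole Laplacian \<open>gxx + gyy\<close>.\<close>
    have "(gyy x has_integral (gy x (2 * pi) - gy x 0)) {0..2 * pi}"
      using C2 that unfolding C2_periodic_strip_def
      by (intro fundamental_theorem_of_calculus)
         (auto simp: has_real_derivative_iff_has_vector_derivative[symmetric]
           intro: has_field_derivative_at_within)
    moreover have "gy x (2 * pi) - gy x 0 = 0"
      using C2 unfolding C2_periodic_strip_def by (metis add_0 diff_self)
    ultimately have yy: "(gyy x has_integral 0) {0..2 * pi}" by simp
    have xx: "(gxx x has_integral m'' x) {0..2 * pi}"
      unfolding m''_def using C2 that int[of gxx x] unfolding C2_periodic_strip_def
      by (auto intro: integrable_integral)
    show ?thesis
      using has_integral_nonneg[OF has_integral_add[OF xx yy]] sub[OF that] by simp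
  qed
  then have mono': "m' x1 \<le> m' x2" if "x1 \<le> x2" "x2 < 0" for x1 x2
    using that dm(2) by (intro DERIV_nonneg_imp_nondecreasing[of x1 x2 m']) (meson order.strict_trans1)+
  have nonneg: "0 \<le> m' x0" if "x0 < 0" for x0
  proof (rule ccontr)
    assume "\<not> 0 \<le> m' x0"
    then have neg: "m' x0 < 0" by simp
    \<comment> \<open>To the left of \<open>x0\<close> the convex \<open>m\<close> lies above its
      tangent at \<open>x0\<close>. A tangent of negative slope would force \<open>m\<close> to
      infinity at minus infinity, against the finite limit \<open>c\<close>.\<close>
    have lower: "m x0 + m' x0 * (x - x0) \<le> m x" if "x \<le> x0" for x
    proof -
      have "m x0 - m' x0 * x0 \<le> m x - m' x0 * x"
      proof (rule DERIV_nonpos_imp_nonincreasing[OF that])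
        fix t assume "x \<le> t" "t \<le> x0"
        then have "((\<lambda>t. m t - m' x0 * t) has_real_derivative (m' t - m' x0)) (at t)"
          "m' t - m' x0 \<le> 0"
          using \<open>x0 < 0\<close> mono'[of t x0] by (auto intro!: derivative_eq_intros dm)
        then show "\<exists>y. ((\<lambda>t. m t - m' x0 * t) has_real_derivative y) (at t) \<and> y \<le> 0" by blast
      qed
      then show ?thesis by (simp add: algebra_simps)
    qed
    have "filterlim (\<lambda>x. m' x0 * x + (m x0 - m' x0 * x0)) at_top at_bot"
      using neg by real_asymp
    then have "filterlim m at_top at_bot"
      by (rule filterlim_at_top_mono)
         (auto simp: eventually_at_bot_linorder algebra_simps intro!: exI[of _ x0] dest: lower)
    then show False
      using lim not_tendsto_and_filterlim_at_infinity[of at_bot m c]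
      by (auto simp: m_def[abs_def] dest: filterlim_at_top_imp_at_infinity)
  qed
  have "m t \<le> m x" if "t \<le> x" for t
    using that dm(1) nonneg \<open>x < 0\<close> by (intro DERIV_nonneg_imp_nondecreasing[of t x m]) (meson order.strict_trans1)+
  then have "c \<le> m x"
    using lim unfolding m_def[symmetric]
    by (intro tendsto_upperbound[of m c at_bot]) (auto simp: eventually_at_bot_linorder)
  then show ?thesis by (simp add: m_def)
qed

lemma C2_periodic_strip_diff:
  assumes "C2_periodic_strip g gx gy gxx gyy" "C2_periodic_strip h hx hy hxx hyy"
  shows "C2_periodic_strip (\<lambda>x y. a * g x y - b * h x y) (\<lambda>x y. a * gx x y - b * hx x y)
     (\<lambda>x y. a * gy x y - b * hy x y) (\<lambda>x y. a * gxx x y - b * hxx x y) (\<lambda>x y. a * gyy x y - b * hyy x y)"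
  using assms unfolding C2_periodic_strip_def
  by (auto intro!: DERIV_diff DERIV_cmult continuous_intros)

section \<open>Circle integrals on the disk as integrals on the strip\<close>

lemma circle_integrable:
  fixes g :: "complex \<Rightarrow> real"
  assumes "continuous_on unit_disk g" "x < 0"
  shows "(\<lambda>y. g (exp (Complex x y))) integrable_on {0..2 * pi}"
proof (rule integrable_continuous_interval, rule continuous_on_compose2[OF assms(1)])
  show "continuous_on {0..2 * pi} (\<lambda>y. exp (Complex x y))"
    unfolding Complex_eq by (intro continuous_intros)
qed (use assms in auto)

lemma exp_Complex: "exp (Complex x y) = of_real (exp x) * cis y"
  by (simp add: complex_eq_iff Re_exp Im_exp)

lemma circle_integral_tendsto:
  fixes \<Psi> :: "complex \<Rightarrow> real"
  assumes "continuous_on unit_disk \<Psi>"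
  shows "((\<lambda>x. integral {0..2 * pi} (\<lambda>y. \<Psi> (exp (Complex x y)))) \<longlongrightarrow> 2 * pi * \<Psi> 0) at_bot"
proof -
  have "continuous_on ({-1<..<1} \<times> cbox 0 (2 * pi)) (\<lambda>w::real \<times> real. \<Psi> (of_real (fst w) * cis (snd w)))"
  proof (rule continuous_on_compose2[OF assms])
    show "continuous_on ({-1<..<1} \<times> cbox 0 (2 * pi)) (\<lambda>w::real \<times> real. of_real (fst w) * cis (snd w))"
      by (intro continuous_intros)
  qed (auto simp: norm_mult)
  then have "continuous_on {-1<..<1} (\<lambda>r::real. integral (cbox 0 (2 * pi)) (\<lambda>t. \<Psi> (of_real r * cis t)))"
    by (intro integral_continuous_on_param) (simp add: case_prod_unfold)
  then have "isCont (\<lambda>r::real. integral {0..2 * pi} (\<lambda>t. \<Psi> (of_real r * cis t))) 0"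
    by (simp add: continuous_on_eq_continuous_at)
  from isCont_tendsto_compose[OF this exp_at_bot] show ?thesis
    by (simp add: exp_Complex)
qed

lemma subharmonic_circle_mean:
  assumes "continuous_on unit_disk \<Psi>"
    and "C2_periodic_strip (\<lambda>x y. \<Psi> (exp (Complex x y))) gx gy gxx gyy"
    and "\<And>x y. x < 0 \<Longrightarrow> 0 \<le> gxx x y + gyy x y" and "x < 0"
  shows "2 * pi * \<Psi> 0 \<le> integral {0..2 * pi} (\<lambda>y. \<Psi> (exp (Complex x y)))"
  using subharmonic_strip_mean[OF assms(2,3) _ assms(4)] circle_integral_tendsto[OF assms(1)] by blast

text \<open>The second derivatives are written with \<open>g x y powr (q - 2)\<close> factored out,
  so that their sum has the shape of \<open>\<Delta>\<close> in
  \<open>powr_laplacian_bounds\<close>.\<close>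

lemma C2_periodic_strip_powr:
  assumes C2: "C2_periodic_strip g gx gy gxx gyy" and pos: "\<And>x y. x < 0 \<Longrightarrow> 0 < g x y"
    and per: "\<And>x y. g x (y + 2 * pi) = g x y"
  shows "C2_periodic_strip (\<lambda>x y. g x y powr q)
     (\<lambda>x y. q * g x y powr (q - 1) * gx x y) (\<lambda>x y. q * g x y powr (q - 1) * gy x y)
     (\<lambda>x y. q * g x y powr (q - 2) * ((q - 1) * (gx x y)\<^sup>2 + g x y * gxx x y))
     (\<lambda>x y. q * g x y powr (q - 2) * ((q - 1) * (gy x y)\<^sup>2 + g x y * gyy x y))"
proof -
  have pw: "t powr (q - 1) = t * t powr (q - 2)" if "0 < t" for t :: real
    using that powr_add[of t 1 "q - 2"] by simp
  have d1: "((\<lambda>x. h x powr r) has_real_derivative r * h x powr (r - 1) * h') (at x)"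
    if "(h has_real_derivative h') (at x)" "0 < h x" for h :: "real \<Rightarrow> real" and h' x r
    using DERIV_powr[OF that DERIV_const[of r]] that(2) by (simp add: powr_diff field_simps)
  have d2: "((\<lambda>x. q * h x powr (q - 1) * k x) has_real_derivative
      q * h x powr (q - 2) * ((q - 1) * (k x)\<^sup>2 + h x * k')) (at x)"
    if "(h has_real_derivative k x) (at x)" "(k has_real_derivative k') (at x)" "0 < h x"
    for h k :: "real \<Rightarrow> real" and k' x
  proof -
    have "((\<lambda>x. q * h x powr (q - 1) * k x) has_real_derivative
      q * ((q - 1) * h x powr (q - 1 - 1) * k x) * k x + q * h x powr (q - 1) * k') (at x)"
      by (rule derivative_eq_intros d1[OF that(1,3)] that refl | simp add: algebra_simps)+
    then show ?thesis
      using pw[OF that(3)] by (simp add: algebra_simps power2_eq_square)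
  qed
  have cont: "continuous_on ({..<0} \<times> UNIV) (\<lambda>w. g (fst w) (snd w) powr r)" for r
    using C2 pos unfolding C2_periodic_strip_def
    by (intro continuous_intros) (auto simp: less_imp_neq[symmetric] dest: order.strict_implies_not_eq)
  show ?thesis
    using C2 pos per unfolding C2_periodic_strip_def
    by (auto intro!: d1 d2 continuous_intros cont)
qed

section \<open>The gradient estimate and pointwise inequalities\<close>

text \<open>The distortion inequality compares continuous functions, so the set where it fails is
  open as well as negligible, hence empty. Pointwise, \<open>(Lambda f z)^2\<close> is at least half
  the sum of both squared gradients, while the Jacobian is bilinear in the gradients of the real and
  imaginary parts.\<close>

lemma harmonic_quasiregular_gradient:
  assumes hq: "harmonic_quasiregular K K' f" and z: "z \<in> unit_disk"
  shows "(Im (partial_x f z))\<^sup>2 + (Im (partial_y f z))\<^sup>2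
    \<le> 4 * K\<^sup>2 * ((Re (partial_x f z))\<^sup>2 + (Re (partial_y f z))\<^sup>2) + 4 * K'"
proof -
  define Q where "Q z = (Lambda f z)\<^sup>2 - K * Jac f z" for z
  define N where "N = {z \<in> unit_disk. K' < Q z}"
  have "continuous_on unit_disk (partial_x f)" "continuous_on unit_disk (partial_y f)"
    using hq by (auto simp: harmonic_quasiregular_def complex_harmonic_on_def C2_on_def C1_on_def)
  then have "continuous_on unit_disk Q"
    unfolding Q_def Lambda_def Jac_def wirtinger_def wirtinger_bar_def by (intro continuous_intros) auto
  then have "open (unit_disk \<inter> Q -` {K'<..})"
    by (intro continuous_open_preimage) auto
  moreover have "unit_disk \<inter> Q -` {K'<..} = N"
    by (auto simp: N_def)
  ultimately have "open N" by simp
  moreover have "AE z in lebesgue. z \<in> unit_disk \<longrightarrow> (Lambda f z)\<^sup>2 \<le> K * Jac f z + K'"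
    using hq by (simp add: harmonic_quasiregular_def quasiregular_def)
  then have "negligible N"
    unfolding eventually_ae_filter_negligible
    by (elim exE conjE, elim negligible_subset) (force simp: N_def Q_def)
  ultimately have "N = {}"
    using open_not_negligible by blast
  then have "Q z \<le> K'"
    using z by (auto simp: N_def)
  moreover define a b c d where "a = Re (partial_x f z)" "b = Im (partial_x f z)"
    "c = Re (partial_y f z)" "d = Im (partial_y f z)"
  have W: "(cmod (wirtinger f z))\<^sup>2 = ((a + d) / 2)\<^sup>2 + ((b - c) / 2)\<^sup>2"
    "(cmod (wirtinger_bar f z))\<^sup>2 = ((a - d) / 2)\<^sup>2 + ((b + c) / 2)\<^sup>2"
    unfolding cmod_power2 wirtinger_def wirtinger_bar_def a_b_c_d_def by simp_all
  then have J: "Jac f z = a * d - b * c"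
    by (simp add: Jac_def field_simps power2_eq_square)
  have "(cmod (wirtinger f z))\<^sup>2 + (cmod (wirtinger_bar f z))\<^sup>2 \<le> (Lambda f z)\<^sup>2"
    by (simp add: Lambda_def power2_sum)
  moreover have "(cmod (wirtinger f z))\<^sup>2 + (cmod (wirtinger_bar f z))\<^sup>2 = ((a\<^sup>2 + c\<^sup>2) + (b\<^sup>2 + d\<^sup>2)) / 2"
    unfolding W by (simp add: field_simps power2_eq_square)
  ultimately have "((a\<^sup>2 + c\<^sup>2) + (b\<^sup>2 + d\<^sup>2)) / 2 \<le> K * (a * d - b * c) + K'"
    unfolding Q_def J by linarith
  \<comment> \<open>The weights leave one quarter of \<open>b^2 + d^2\<close> on the right against
    one half on the left; the remaining quarter explains the factors 4 in the conclusion.\<close>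
  moreover have "K * (a * d - b * c) \<le> K\<^sup>2 * (a\<^sup>2 + c\<^sup>2) + (b\<^sup>2 + d\<^sup>2) / 4"
    using zero_le_power2[of "d / 2 - K * a"] zero_le_power2[of "b / 2 + K * c"]
    by (simp add: power2_eq_square field_simps)
  moreover have "0 \<le> a\<^sup>2 + c\<^sup>2" by simp
  ultimately have "b\<^sup>2 + d\<^sup>2 \<le> 4 * (K\<^sup>2 * (a\<^sup>2 + c\<^sup>2)) + 4 * K'"
    by argo
  then show ?thesis by (simp add: a_b_c_d_def)
qed

text \<open>
  \<open>\<Delta>\<close> is the Laplacian of \<open>T\<^sup>q\<close> when \<open>G\<close> is the squared gradient and \<open>2 N\<close> the Laplacian of \<open>T\<close>.
\<close>

lemma powr_laplacian_bounds:
  fixes T N G q :: real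
  assumes T: "0 < T" and G: "0 \<le> G" "G \<le> 4 * T * N" and q: "0 < q"
  defines "\<Delta> \<equiv> q * T powr (q - 2) * ((q - 1) * G + T * (2 * N))"
  shows "1 \<le> q \<Longrightarrow> 2 * q * (N * T powr (q - 1)) \<le> \<Delta>"
    and "1 \<le> q \<Longrightarrow> \<Delta> \<le> 2 * q * (2 * q - 1) * (N * T powr (q - 1))"
    and "q \<le> 1 \<Longrightarrow> 2 * q * (2 * q - 1) * (N * T powr (q - 1)) \<le> \<Delta>"
    and "q \<le> 1 \<Longrightarrow> \<Delta> \<le> 2 * q * (N * T powr (q - 1))"
proof -
  have pw: "T powr (q - 1) = T * T powr (q - 2)"
    using T powr_add[of T 1 "q - 2"] by simp
  have \<Delta>: "\<Delta> = q * T powr (q - 2) * ((q - 1) * G + 2 * (T * N))"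
    by (simp add: \<Delta>_def)
  \<comment> \<open>\<open>N1\<close> and \<open>N2\<close> express the values of
    \<open>\<Delta>\<close> at the extremes \<open>G = 0\<close> and \<open>G = 4 * T * N\<close>.
    As \<open>\<Delta>\<close> is affine in \<open>G\<close> with a slope of the sign of
    \<open>q - 1\<close>, they bound it, in an order that depends on whether \<open>q\<close> is
    above or below 1.\<close>
  have N1: "2 * q * (N * T powr (q - 1)) = q * T powr (q - 2) * (2 * (T * N))"
    and N2: "2 * q * (2 * q - 1) * (N * T powr (q - 1)) = q * T powr (q - 2) * ((q - 1) * (4 * (T * N)) + 2 * (T * N))"
    unfolding pw by algebra+
  note mono = mult_left_mono[of _ _ "q * T powr (q - 2)"]
  have G': "G \<le> 4 * (T * N)" using G by simp
  show "2 * q * (N * T powr (q - 1)) \<le> \<Delta>" if "1 \<le> q"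
    unfolding \<Delta> N1 using that G q by (intro mono) auto
  show "\<Delta> \<le> 2 * q * (2 * q - 1) * (N * T powr (q - 1))" if "1 \<le> q"
    unfolding \<Delta> N2 using that G' q by (intro mono add_right_mono mult_left_mono) auto
  show "2 * q * (2 * q - 1) * (N * T powr (q - 1)) \<le> \<Delta>" if "q \<le> 1"
    unfolding \<Delta> N2 using that G' q by (intro mono add_right_mono mult_left_mono_neg) auto
  show "\<Delta> \<le> 2 * q * (N * T powr (q - 1))" if "q \<le> 1"
    unfolding \<Delta> N1 using that G q by (intro mono) (auto simp: mult_nonpos_nonneg)
qed

text \<open>Lagrange's identity for the vectors \<open>(v, u, 1)\<close> and
  \<open>(v', u', 1)\<close> with weights \<open>a\<close>, \<open>b\<close>,
  \<open>c\<close>.\<close>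

lemma weighted_cauchy_schwarz:
  fixes a b c :: real
  assumes "0 \<le> a" "0 \<le> b" "0 \<le> c"
  shows "(a * v * v' + b * u * u' + c)\<^sup>2 \<le> (a * v\<^sup>2 + b * u\<^sup>2 + c) * (a * v'\<^sup>2 + b * u'\<^sup>2 + c)"
proof -
  have "(a * v\<^sup>2 + b * u\<^sup>2 + c) * (a * v'\<^sup>2 + b * u'\<^sup>2 + c) - (a * v * v' + b * u * u' + c)\<^sup>2
      = a * b * (v * u' - u * v')\<^sup>2 + a * c * (v - v')\<^sup>2 + b * c * (u - u')\<^sup>2"
    by algebra
  moreover have "\<dots> \<ge> 0"
    using assms by (intro add_nonneg_nonneg mult_nonneg_nonneg) auto
  ultimately show ?thesis by linarith
qed

section \<open>Subharmonic functions built from a quasiregular mapping\<close>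

lemma abs_powr_double: "\<bar>x\<bar> powr (2 * q) = x\<^sup>2 powr q" for x q :: real
proof (cases "x = 0")
  case False
  then have "x\<^sup>2 = \<bar>x\<bar> powr 2" by simp
  then show ?thesis by (simp only: powr_powr)
qed simp

text \<open>The term \<open>2 * k\<close> is the squared gradient of
  \<open>(sqrt k * x, sqrt k * y)\<close>. It makes the estimate homogeneous: the gradient of
  \<open>Im f\<close> is dominated by that of one harmonic vector, with a factor \<open>B\<close>
  into which \<open>K'\<close> need not enter.\<close>

locale gradient_dominated =
  fixes f :: "complex \<Rightarrow> complex" and k B :: real
  assumes harmonic: "complex_harmonic_on unit_disk f"
    and k_pos: "0 < k" and B_nonneg: "0 \<le> B"
    and Im_0: "Im (f 0) = 0"
    and gradient: "z \<in> unit_disk \<Longrightarrow> (Im (partial_x f z))\<^sup>2 + (Im (partial_y f z))\<^sup>2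
      \<le> B * ((Re (partial_x f z))\<^sup>2 + (Re (partial_y f z))\<^sup>2 + 2 * k)"
begin

definition S :: "complex \<Rightarrow> real" where
  "S z = (Re (f z))\<^sup>2 + k * (1 + (cmod z)\<^sup>2)"

text \<open>Three instances occur: \<open>T 1 1\<close> is \<open>v^2 + S\<close>,
  \<open>T 1 \<beta>\<close> serves the exponents \<open>q\<close> from 1 upwards, and
  \<open>T 0 1 = S\<close> serves those up to 1.\<close>

definition T :: "real \<Rightarrow> real \<Rightarrow> complex \<Rightarrow> real" where
  "T \<alpha> \<beta> z = \<alpha> * (Im (f z))\<^sup>2 + \<beta> * S z"

definition U :: "real \<Rightarrow> real \<Rightarrow> real" where "U x y = Re (f (exp (Complex x y)))"
definition V :: "real \<Rightarrow> real \<Rightarrow> real" where "V x y = Im (f (exp (Complex x y)))"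
definition Ux :: "real \<Rightarrow> real \<Rightarrow> real" where "Ux x y = Re (log_polar_dx f x y)"
definition Vx :: "real \<Rightarrow> real \<Rightarrow> real" where "Vx x y = Im (log_polar_dx f x y)"
definition Uy :: "real \<Rightarrow> real \<Rightarrow> real" where "Uy x y = Re (log_polar_dy f x y)"
definition Vy :: "real \<Rightarrow> real \<Rightarrow> real" where "Vy x y = Im (log_polar_dy f x y)"
definition Uxx :: "real \<Rightarrow> real \<Rightarrow> real" where "Uxx x y = Re (log_polar_dxx f x y)"
definition Vxx :: "real \<Rightarrow> real \<Rightarrow> real" where "Vxx x y = Im (log_polar_dxx f x y)"
definition Uyy :: "real \<Rightarrow> real \<Rightarrow> real" where "Uyy x y = Re (log_polar_dyy f x y)"
definition Vyy :: "real \<Rightarrow> real \<Rightarrow> real" where "Vyy x y = Im (log_polar_dyy f x y)"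

definition Tx :: "real \<Rightarrow> real \<Rightarrow> real \<Rightarrow> real \<Rightarrow> real" where
  "Tx \<alpha> \<beta> x y = 2 * (\<alpha> * V x y * Vx x y + \<beta> * U x y * Ux x y + \<beta> * k * exp (2 * x))"

definition Ty :: "real \<Rightarrow> real \<Rightarrow> real \<Rightarrow> real \<Rightarrow> real" where
  "Ty \<alpha> \<beta> x y = 2 * (\<alpha> * V x y * Vy x y + \<beta> * U x y * Uy x y)"

definition Txx :: "real \<Rightarrow> real \<Rightarrow> real \<Rightarrow> real \<Rightarrow> real" where
  "Txx \<alpha> \<beta> x y = 2 * (\<alpha> * ((Vx x y)\<^sup>2 + V x y * Vxx x y) + \<beta> * ((Ux x y)\<^sup>2 + U x y * Uxx x y)
      + 2 * \<beta> * k * exp (2 * x))"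

definition Tyy :: "real \<Rightarrow> real \<Rightarrow> real \<Rightarrow> real \<Rightarrow> real" where
  "Tyy \<alpha> \<beta> x y = 2 * (\<alpha> * ((Vy x y)\<^sup>2 + V x y * Vyy x y) + \<beta> * ((Uy x y)\<^sup>2 + U x y * Uyy x y))"

text \<open>On the strip \<open>x < 0\<close>, \<open>D\<close> is the squared gradient, in
  logarithmic polar coordinates, of the harmonic vector whose squared length is \<open>S\<close>;
  \<open>E\<close> is that of \<open>v\<close>.\<close>

definition D :: "real \<Rightarrow> real \<Rightarrow> real" where
  "D x y = (Ux x y)\<^sup>2 + (Uy x y)\<^sup>2 + 2 * k * exp (2 * x)"

definition E :: "real \<Rightarrow> real \<Rightarrow> real" where
  "E x y = (Vx x y)\<^sup>2 + (Vy x y)\<^sup>2"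

section \<open>Derivatives, Laplacian and gradient of \<open>T\<close>\<close>

lemma f_C2: "C2_on unit_disk f" and f_C1: "C1_on unit_disk f"
  using harmonic by (auto simp: complex_harmonic_on_def C2_on_def)

lemma T_exp: "T \<alpha> \<beta> (exp (Complex x y)) = \<alpha> * (V x y)\<^sup>2 + \<beta> * ((U x y)\<^sup>2 + k * (1 + exp (2 * x)))"
  by (simp add: T_def S_def U_def V_def exp_double)

lemma S_pos: "0 < S z"
  unfolding S_def using k_pos by (intro add_nonneg_pos mult_pos_pos add_pos_nonneg) auto

lemma T_pos: "0 \<le> \<alpha> \<Longrightarrow> 0 < \<beta> \<Longrightarrow> 0 < T \<alpha> \<beta> z"
  using S_pos by (auto simp: T_def intro!: add_nonneg_pos)

lemma continuous_T: "continuous_on unit_disk (T \<alpha> \<beta>)"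
  unfolding T_def S_def using C1_on_imp_continuous_on[OF f_C1] by (intro continuous_intros) auto

lemma D_nonneg: "0 \<le> D x y" and E_nonneg: "0 \<le> E x y"
  using k_pos by (simp_all add: D_def E_def)

lemma E_le: "x < 0 \<Longrightarrow> E x y \<le> B * D x y"
  using mult_left_mono[OF gradient[of "exp (Complex x y)"], of "exp (2 * x)"]
  unfolding E_def D_def Ux_def Uy_def Vx_def Vy_def norm_log_polar_gradient
  by (simp add: algebra_simps)

lemma T_strip:
  "C2_periodic_strip (\<lambda>x y. T \<alpha> \<beta> (exp (Complex x y))) (Tx \<alpha> \<beta>) (Ty \<alpha> \<beta>) (Txx \<alpha> \<beta>) (Tyy \<alpha> \<beta>)"
proof -
  note dx = has_vector_derivative_Re_Im[OF C1_on_log_polar(1)[OF f_C1]]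
    has_vector_derivative_Re_Im[OF C2_on_log_polar(1)[OF f_C2]]
  note dx = dx[folded U_def V_def Ux_def Vx_def Uxx_def Vxx_def]
  note dy = has_vector_derivative_Re_Im[OF C1_on_log_polar(2)[OF f_C1]]
    has_vector_derivative_Re_Im[OF C2_on_log_polar(2)[OF f_C2]]
  note dy = dy[folded U_def V_def Uy_def Vy_def Uyy_def Vyy_def]
  note cont = continuous_on_Re[OF continuous_on_log_polar(1)[OF f_C1]]
    continuous_on_Im[OF continuous_on_log_polar(1)[OF f_C1]]
    continuous_on_Re[OF continuous_on_log_polar(2)[OF f_C1]]
    continuous_on_Im[OF continuous_on_log_polar(2)[OF f_C1]]
    continuous_on_Re[OF continuous_on_log_polar_dxx[OF f_C2]]
    continuous_on_Im[OF continuous_on_log_polar_dxx[OF f_C2]]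
  note cont = cont[folded U_def V_def Ux_def Vx_def Uxx_def Vxx_def]
  have per: "Ty \<alpha> \<beta> x (y + 2 * pi) = Ty \<alpha> \<beta> x y" for x y
  proof -
    have "exp (Complex x (y + 2 * pi)) = exp (Complex x y)"
      by (simp add: complex_eq_iff Re_exp Im_exp)
    then show ?thesis
      by (simp add: Ty_def U_def V_def Uy_def Vy_def log_polar_periodic)
  qed
  have "((\<lambda>x. T \<alpha> \<beta> (exp (Complex x y))) has_real_derivative Tx \<alpha> \<beta> x y) (at x)"
    "((\<lambda>x. Tx \<alpha> \<beta> x y) has_real_derivative Txx \<alpha> \<beta> x y) (at x)" if "x < 0" for x y
    unfolding T_exp Tx_def Txx_def
    by (auto intro!: derivative_eq_intros dx that simp: algebra_simps power2_eq_square)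
  moreover have "((\<lambda>y. T \<alpha> \<beta> (exp (Complex x y))) has_real_derivative Ty \<alpha> \<beta> x y) (at y)"
    "(Ty \<alpha> \<beta> x has_real_derivative Tyy \<alpha> \<beta> x y) (at y)" if "x < 0" for x y
    unfolding T_exp Ty_def[abs_def] Tyy_def
    by (auto intro!: derivative_eq_intros dy that simp: algebra_simps power2_eq_square)
  moreover have "continuous_on ({..<0} \<times> UNIV) (\<lambda>w. T \<alpha> \<beta> (exp (Complex (fst w) (snd w))))"
    "continuous_on ({..<0} \<times> UNIV) (\<lambda>w. Tx \<alpha> \<beta> (fst w) (snd w))"
    "continuous_on ({..<0} \<times> UNIV) (\<lambda>w. Txx \<alpha> \<beta> (fst w) (snd w))"
    unfolding T_exp Tx_def Txx_def by (intro continuous_intros cont)+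
  ultimately show ?thesis
    unfolding C2_periodic_strip_def using per by auto
qed

text \<open>The Laplacian of a sum of squares of harmonic functions is twice the sum of their
  squared gradients, because the terms with second derivatives cancel.\<close>

lemma T_laplacian: "x < 0 \<Longrightarrow> Txx \<alpha> \<beta> x y + Tyy \<alpha> \<beta> x y = 2 * (\<alpha> * E x y + \<beta> * D x y)"
proof -
  assume "x < 0"
  then have "Uxx x y + Uyy x y = 0" "Vxx x y + Vyy x y = 0"
    using log_polar_laplacian[OF harmonic, of x y]
    by (simp_all add: Uxx_def Uyy_def Vxx_def Vyy_def flip: plus_complex.sel)
  then have "Uyy x y = - Uxx x y" "Vyy x y = - Vxx x y" by linarith+
  then show ?thesis
    by (simp add: Txx_def Tyy_def D_def E_def algebra_simps)
qed

text \<open>For a vector \<open>F\<close> with \<open>T = |F|^2\<close>, Cauchy-Schwarz bounds each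
  derivative of \<open>T\<close>, being twice the product of \<open>F\<close> with its derivative.
  The result is the hypothesis on \<open>G\<close> in \<open>powr_laplacian_bounds\<close>.\<close>

lemma T_gradient:
  assumes "0 \<le> \<alpha>" "0 \<le> \<beta>"
  shows "(Tx \<alpha> \<beta> x y)\<^sup>2 + (Ty \<alpha> \<beta> x y)\<^sup>2
    \<le> 4 * T \<alpha> \<beta> (exp (Complex x y)) * (\<alpha> * E x y + \<beta> * D x y)"
proof -
  define e where "e = \<beta> * k * exp (2 * x)"
  have e: "0 \<le> e" using assms k_pos by (simp add: e_def)
  define \<tau> where "\<tau> = \<alpha> * (V x y)\<^sup>2 + \<beta> * (U x y)\<^sup>2 + e"
  have "(Tx \<alpha> \<beta> x y)\<^sup>2 = 4 * (\<alpha> * V x y * Vx x y + \<beta> * U x y * Ux x y + e)\<^sup>2"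
    by (simp only: Tx_def e_def power_mult_distrib) simp
  also have "\<dots> \<le> 4 * (\<tau> * (\<alpha> * (Vx x y)\<^sup>2 + \<beta> * (Ux x y)\<^sup>2 + e))"
    unfolding \<tau>_def using weighted_cauchy_schwarz[OF assms e, of "V x y" "Vx x y" "U x y" "Ux x y"] by simp
  finally have 1: "(Tx \<alpha> \<beta> x y)\<^sup>2 \<le> 4 * (\<tau> * (\<alpha> * (Vx x y)\<^sup>2 + \<beta> * (Ux x y)\<^sup>2 + e))" .
  \<comment> \<open>Varying \<open>y\<close> moves \<open>z\<close> along its circle and leaves
    \<open>|z|\<close> fixed, so the third weight is 0 here, whereas it is \<open>e\<close> in the
    x-direction.\<close>
  have "(Ty \<alpha> \<beta> x y)\<^sup>2 = 4 * (\<alpha> * V x y * Vy x y + \<beta> * U x y * Uy x y + 0)\<^sup>2"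
    by (simp only: Ty_def power_mult_distrib) simp
  also have "\<dots> \<le> 4 * ((\<tau> - e) * (\<alpha> * (Vy x y)\<^sup>2 + \<beta> * (Uy x y)\<^sup>2))"
    unfolding \<tau>_def using weighted_cauchy_schwarz[OF assms order_refl, of "V x y" "Vy x y" "U x y" "Uy x y"] by simp
  also have "\<dots> \<le> 4 * (\<tau> * (\<alpha> * (Vy x y)\<^sup>2 + \<beta> * (Uy x y)\<^sup>2))"
    using e assms by (intro mult_left_mono mult_right_mono) auto
  finally have "(Tx \<alpha> \<beta> x y)\<^sup>2 + (Ty \<alpha> \<beta> x y)\<^sup>2
      \<le> 4 * (\<tau> * (\<alpha> * E x y + \<beta> * ((Ux x y)\<^sup>2 + (Uy x y)\<^sup>2) + e))"
    using 1 by (simp add: E_def algebra_simps)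
  \<comment> \<open>Both factors grow: \<open>T\<close> equals \<open>\<tau> + \<beta> * k\<close>,
    and \<open>\<beta> * D\<close> contains \<open>2 * e\<close> in place of
    \<open>e\<close>.\<close>
  also have "\<dots> \<le> 4 * (T \<alpha> \<beta> (exp (Complex x y)) * (\<alpha> * E x y + \<beta> * D x y))"
    using assms k_pos e E_nonneg[of x y] D_nonneg[of x y]
    by (intro mult_left_mono mult_mono)
       (auto simp: \<tau>_def e_def T_exp D_def algebra_simps intro!: add_nonneg_nonneg mult_nonneg_nonneg)
  finally show ?thesis by simp
qed

text \<open>For \<open>x < 0\<close> this is the Laplacian of \<open>T \<alpha> \<beta>\<close> to
  the power \<open>q\<close> in logarithmic polar coordinates, with the Laplacian of
  \<open>T\<close> already replaced by its value from \<open>T_laplacian\<close>.\<close>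

definition lap :: "real \<Rightarrow> real \<Rightarrow> real \<Rightarrow> real \<Rightarrow> real \<Rightarrow> real" where
  "lap q \<alpha> \<beta> x y = q * T \<alpha> \<beta> (exp (Complex x y)) powr (q - 2)
     * ((q - 1) * ((Tx \<alpha> \<beta> x y)\<^sup>2 + (Ty \<alpha> \<beta> x y)\<^sup>2)
        + T \<alpha> \<beta> (exp (Complex x y)) * (2 * (\<alpha> * E x y + \<beta> * D x y)))"

text \<open>The assumption on \<open>lap\<close> says that the integrand is subharmonic, and
  \<open>b \<le> a * \<beta> powr q\<close> makes it nonnegative at the centre; the mean value
  inequality does the rest.\<close>

lemma mean_nonneg:
  assumes "0 \<le> \<alpha>" "0 < \<beta>" "b \<le> a * \<beta> powr q" "x < 0"
    and lap: "\<And>x y. x < 0 \<Longrightarrow> b * lap q 1 1 x y \<le> a * lap q \<alpha> \<beta> x y"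
  shows "0 \<le> integral {0..2 * pi}
    (\<lambda>y. a * T \<alpha> \<beta> (exp (Complex x y)) powr q - b * T 1 1 (exp (Complex x y)) powr q)"
proof -
  define \<Psi> where "\<Psi> z = a * T \<alpha> \<beta> z powr q - b * T 1 1 z powr q" for z
  have per: "T \<alpha> \<beta> (exp (Complex x (y + 2 * pi))) = T \<alpha> \<beta> (exp (Complex x y))" for \<alpha> \<beta> x y
    by (rule arg_cong[of _ _ "T \<alpha> \<beta>"]) (simp add: complex_eq_iff Re_exp Im_exp)
  have strip: "C2_periodic_strip (\<lambda>x y. T \<alpha> \<beta> (exp (Complex x y)) powr q)
     (\<lambda>x y. q * T \<alpha> \<beta> (exp (Complex x y)) powr (q - 1) * Tx \<alpha> \<beta> x y)
     (\<lambda>x y. q * T \<alpha> \<beta> (exp (Complex x y)) powr (q - 1) * Ty \<alpha> \<beta> x y)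
     (\<lambda>x y. q * T \<alpha> \<beta> (exp (Complex x y)) powr (q - 2)
        * ((q - 1) * (Tx \<alpha> \<beta> x y)\<^sup>2 + T \<alpha> \<beta> (exp (Complex x y)) * Txx \<alpha> \<beta> x y))
     (\<lambda>x y. q * T \<alpha> \<beta> (exp (Complex x y)) powr (q - 2)
        * ((q - 1) * (Ty \<alpha> \<beta> x y)\<^sup>2 + T \<alpha> \<beta> (exp (Complex x y)) * Tyy \<alpha> \<beta> x y))"
    if "0 \<le> \<alpha>" "0 < \<beta>" for \<alpha> \<beta>
    by (rule C2_periodic_strip_powr[OF T_strip T_pos[OF that] per])
  have lap_eq: "q * T \<alpha> \<beta> (exp (Complex x y)) powr (q - 2)
        * ((q - 1) * (Tx \<alpha> \<beta> x y)\<^sup>2 + T \<alpha> \<beta> (exp (Complex x y)) * Txx \<alpha> \<beta> x y)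
      + q * T \<alpha> \<beta> (exp (Complex x y)) powr (q - 2)
        * ((q - 1) * (Ty \<alpha> \<beta> x y)\<^sup>2 + T \<alpha> \<beta> (exp (Complex x y)) * Tyy \<alpha> \<beta> x y)
      = lap q \<alpha> \<beta> x y" if "x < 0" for \<alpha> \<beta> x y
    unfolding lap_def T_laplacian[OF that, symmetric] by (simp add: algebra_simps)
  have ne: "T \<alpha> \<beta> z \<noteq> 0" "T 1 1 z \<noteq> 0" for z
    using T_pos[OF assms(1,2), of z] T_pos[of 1 1 z] by auto
  have cont: "continuous_on unit_disk \<Psi>"
    unfolding \<Psi>_def by (intro continuous_intros continuous_T) (simp_all add: ne)
  note strip_\<Psi> = C2_periodic_strip_diff[OF strip[OF assms(1,2)] strip[OF zero_le_one zero_less_one],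
      of a b, folded \<Psi>_def]
  have "2 * pi * \<Psi> 0 \<le> integral {0..2 * pi} (\<lambda>y. \<Psi> (exp (Complex x y)))"
  proof (rule subharmonic_circle_mean[OF cont strip_\<Psi>])
    show "0 \<le> a * (q * T \<alpha> \<beta> (exp (Complex x y)) powr (q - 2)
        * ((q - 1) * (Tx \<alpha> \<beta> x y)\<^sup>2 + T \<alpha> \<beta> (exp (Complex x y)) * Txx \<alpha> \<beta> x y))
      - b * (q * T 1 1 (exp (Complex x y)) powr (q - 2)
        * ((q - 1) * (Tx 1 1 x y)\<^sup>2 + T 1 1 (exp (Complex x y)) * Txx 1 1 x y))
      + (a * (q * T \<alpha> \<beta> (exp (Complex x y)) powr (q - 2)
        * ((q - 1) * (Ty \<alpha> \<beta> x y)\<^sup>2 + T \<alpha> \<beta> (exp (Complex x y)) * Tyy \<alpha> \<beta> x y))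
      - b * (q * T 1 1 (exp (Complex x y)) powr (q - 2)
        * ((q - 1) * (Ty 1 1 x y)\<^sup>2 + T 1 1 (exp (Complex x y)) * Tyy 1 1 x y)))"
      if "x < 0" for x y
      using lap[OF that, of y] unfolding lap_eq[OF that, symmetric] by (simp only: distrib_left)
  qed fact
  \<comment> \<open>As \<open>Im (f 0) = 0\<close>, both \<open>T \<alpha> \<beta>\<close> and
    \<open>T 1 1\<close> reduce to multiples of \<open>S\<close> at the centre.\<close>
  moreover have "\<Psi> 0 = (a * \<beta> powr q - b) * S 0 powr q"
    using assms S_pos[of 0] by (simp add: \<Psi>_def T_def Im_0 powr_mult algebra_simps)
  then have "0 \<le> 2 * pi * \<Psi> 0"
    using assms by simp
  ultimately show ?thesis
    by (simp add: \<Psi>_def)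
qed

lemma powr_T_S_integrable:
  "x < 0 \<Longrightarrow> 0 \<le> \<alpha> \<Longrightarrow> 0 < \<beta> \<Longrightarrow> (\<lambda>y. T \<alpha> \<beta> (exp (Complex x y)) powr q) integrable_on {0..2 * pi}"
  "x < 0 \<Longrightarrow> (\<lambda>y. S (exp (Complex x y)) powr q) integrable_on {0..2 * pi}"
proof -
  show *: "(\<lambda>y. T \<alpha> \<beta> (exp (Complex x y)) powr q) integrable_on {0..2 * pi}"
    if "x < 0" "0 \<le> \<alpha>" "0 < \<beta>" for x \<alpha> \<beta>
    using T_pos[OF that(2,3)]
    by (intro circle_integrable[of "\<lambda>z. T \<alpha> \<beta> z powr q"] continuous_intros continuous_T that)
       (simp add: order.strict_implies_not_eq[symmetric] less_imp_neq)
  show "x < 0 \<Longrightarrow> (\<lambda>y. S (exp (Complex x y)) powr q) integrable_on {0..2 * pi}"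
    using *[of x 0 1] by (simp add: T_def)
qed

lemma powr_Im_Re_integrable:
  assumes "x < 0" "0 < p"
  shows "(\<lambda>y. \<bar>Im (f (exp (Complex x y)))\<bar> powr p) integrable_on {0..2 * pi}"
    and "(\<lambda>y. \<bar>Re (f (exp (Complex x y)))\<bar> powr p) integrable_on {0..2 * pi}"
  using assms C1_on_imp_continuous_on[OF f_C1]
  by (intro circle_integrable[of "\<lambda>z. \<bar>Im (f z)\<bar> powr p"] circle_integrable[of "\<lambda>z. \<bar>Re (f z)\<bar> powr p"]
      continuous_on_powr' continuous_intros; auto)+

end

text \<open>
  The factor 3/2 only has to be smaller than the coefficient 2 of \<open>(v\<^sup>2 + S)\<^sup>q\<close> in \<open>\<Psi>\<close>.
\<close>

lemma powr_split:
  fixes q \<beta> :: real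
  assumes "0 < q" "0 < \<beta>"
  obtains C where "0 \<le> C"
    "\<And>s t. 0 < s \<Longrightarrow> 0 \<le> t \<Longrightarrow> (t + \<beta> * s) powr q \<le> 3 / 2 * t powr q + C * s powr q"
proof
  \<comment> \<open>\<open>\<delta>\<close> solves \<open>(1 + \<delta>) powr q = 3 / 2\<close>. If
    \<open>\<beta> * s\<close> is at most \<open>\<delta> * t\<close>, the first term on the right
    suffices; otherwise \<open>t\<close> is below \<open>\<beta> * s / \<delta>\<close> and the
    second does.\<close>
  define \<delta> :: real where "\<delta> = (3 / 2) powr (1 / q) - 1"
  have \<delta>: "0 < \<delta>" "(1 + \<delta>) powr q = 3 / 2"
    using assms by (simp_all add: \<delta>_def powr_powr)
  show "0 \<le> ((1 / \<delta> + 1) * \<beta>) powr q" by simp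
  fix s t :: real
  assume s: "0 < s" and t: "0 \<le> t"
  show "(t + \<beta> * s) powr q \<le> 3 / 2 * t powr q + ((1 / \<delta> + 1) * \<beta>) powr q * s powr q"
  proof (cases "\<beta> * s \<le> \<delta> * t")
    case True
    then have "(t + \<beta> * s) powr q \<le> ((1 + \<delta>) * t) powr q"
      using assms s t by (intro powr_mono2) (auto simp: algebra_simps)
    also have "\<dots> = 3 / 2 * t powr q"
      using \<delta> t by (simp add: powr_mult)
    also have "\<dots> \<le> 3 / 2 * t powr q + ((1 / \<delta> + 1) * \<beta>) powr q * s powr q"
      by simp
    finally show ?thesis .
  next
    case False
    then have "(t + \<beta> * s) powr q \<le> ((1 / \<delta> + 1) * \<beta> * s) powr q"
      using assms s t \<delta>(1) by (intro powr_mono2) (auto simp: field_simps)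
    also have "\<dots> = ((1 / \<delta> + 1) * \<beta>) powr q * s powr q"
      using \<delta>(1) s assms by (intro powr_mult)
    also have "\<dots> \<le> 3 / 2 * t powr q + ((1 / \<delta> + 1) * \<beta>) powr q * s powr q"
      by simp
    finally show ?thesis .
  qed
qed

section \<open>The mean of the imaginary part, for exponents above and below 2\<close>

context gradient_dominated begin

text \<open>Twice the upper bound for the Laplacian of \<open>(v^2 + S)^q\<close> must lie below the
  lower bound for that of \<open>(v^2 + \<beta> * S)^q\<close>. Since
  \<open>E + D \<le> (B + 1) * D\<close>, this dictates
  \<open>\<beta> = 2 * (2 * q - 1) * (B + 1)\<close>. The surplus \<open>2 - 3 / 2\<close> in front
  of \<open>|v|^(2 * q)\<close> produces the factor \<open>2 * C\<close>.\<close>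

lemma Im_mean_le_large:
  assumes q: "1 \<le> q" and x: "x < 0" and C: "0 \<le> C"
    and split: "\<And>s t. 0 < s \<Longrightarrow> 0 \<le> t \<Longrightarrow>
      (t + 2 * (2 * q - 1) * (B + 1) * s) powr q \<le> 3 / 2 * t powr q + C * s powr q"
  shows "integral {0..2 * pi} (\<lambda>y. \<bar>Im (f (exp (Complex x y)))\<bar> powr (2 * q))
    \<le> 2 * C * integral {0..2 * pi} (\<lambda>y. S (exp (Complex x y)) powr q)"
proof -
  define \<beta> where "\<beta> = 2 * (2 * q - 1) * (B + 1)"
  have "1 * 1 \<le> (2 * q - 1) * (B + 1)"
    using q B_nonneg by (intro mult_mono) auto
  then have \<beta>: "2 \<le> \<beta>" unfolding \<beta>_def mult.assoc by linarith
  have "0 \<le> integral {0..2 * pi}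
      (\<lambda>y. 1 * T 1 \<beta> (exp (Complex x y)) powr q - 2 * T 1 1 (exp (Complex x y)) powr q)"
  proof (rule mean_nonneg)
    have "2 powr 1 \<le> \<beta> powr q"
      using \<beta> q by (meson order_trans powr_mono powr_mono2 le_numeral_extra(1) one_le_numeral zero_le_numeral zero_le_one)
    then show "2 \<le> 1 * \<beta> powr q" by simp
    fix x y :: real
    assume x: "x < 0"
    note bounds = powr_laplacian_bounds(1,2)[OF T_pos _ T_gradient, folded lap_def]
    have "2 * lap q 1 1 x y \<le> 2 * (2 * q * (2 * q - 1) * ((1 * E x y + 1 * D x y) * T 1 1 (exp (Complex x y)) powr (q - 1)))"
      using bounds(2)[of 1 1 x y q] q by simp
    \<comment> \<open>The exponent \<open>q - 1\<close> is nonnegative, so the larger base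
      \<open>T 1 \<beta>\<close> gives the larger power.\<close>
    also have "\<dots> \<le> 2 * (2 * q * (2 * q - 1) * ((B + 1) * D x y * T 1 \<beta> (exp (Complex x y)) powr (q - 1)))"
    proof (intro mult_left_mono mult_mono powr_mono2)
      show "1 * E x y + 1 * D x y \<le> (B + 1) * D x y"
        using E_le[OF x, of y] by (simp add: algebra_simps)
      show "T 1 1 (exp (Complex x y)) \<le> T 1 \<beta> (exp (Complex x y))"
        using S_pos[of "exp (Complex x y)"] \<beta> by (simp add: T_def)
    qed (use q B_nonneg D_nonneg T_pos[of 1 1 "exp (Complex x y)"] in auto)
    also have "\<dots> = 2 * q * (\<beta> * D x y * T 1 \<beta> (exp (Complex x y)) powr (q - 1))"
      by (simp add: \<beta>_def)
    also have "\<dots> \<le> 2 * q * ((1 * E x y + \<beta> * D x y) * T 1 \<beta> (exp (Complex x y)) powr (q - 1))"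
      using q E_nonneg[of x y] by (intro mult_left_mono mult_right_mono) auto
    also have "\<dots> \<le> lap q 1 \<beta> x y"
      using bounds(1)[of 1 \<beta> x y q] q \<beta> by simp
    finally show "2 * lap q 1 1 x y \<le> 1 * lap q 1 \<beta> x y" by simp
  qed (use \<beta> x in auto)
  also have "\<dots> \<le> integral {0..2 * pi}
      (\<lambda>y. C * S (exp (Complex x y)) powr q - 1 / 2 * \<bar>Im (f (exp (Complex x y)))\<bar> powr (2 * q))"
  proof (rule integral_le)
    fix y :: real
    define z where "z = exp (Complex x y)"
    have V: "\<bar>Im (f z)\<bar> powr (2 * q) = (Im (f z))\<^sup>2 powr q"
      by (rule abs_powr_double)
    have "(Im (f z))\<^sup>2 powr q \<le> T 1 1 z powr q"
      using q S_pos[of z] by (intro powr_mono2) (auto simp: T_def)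
    then show "1 * T 1 \<beta> (exp (Complex x y)) powr q - 2 * T 1 1 (exp (Complex x y)) powr q
      \<le> C * S (exp (Complex x y)) powr q - 1 / 2 * \<bar>Im (f (exp (Complex x y)))\<bar> powr (2 * q)"
      using split[OF S_pos[of z] zero_le_power2[of "Im (f z)"], folded \<beta>_def]
      unfolding z_def[symmetric] V by (simp add: T_def)
  qed (use x q \<beta> in \<open>auto intro!: integrable_diff integrable_on_mult_right powr_T_S_integrable powr_Im_Re_integrable\<close>)
  also have "\<dots> = C * integral {0..2 * pi} (\<lambda>y. S (exp (Complex x y)) powr q)
      - 1 / 2 * integral {0..2 * pi} (\<lambda>y. \<bar>Im (f (exp (Complex x y)))\<bar> powr (2 * q))"
    using x q by (simp add: integral_diff powr_T_S_integrable powr_Im_Re_integrable integrable_on_mult_right)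
  finally show ?thesis by simp
qed

text \<open>The constant \<open>M\<close> makes \<open>M * (2 * q - 1) = B + 1\<close>, which
  balances the lower bound for the Laplacian of \<open>S^q\<close> against the upper bound for that
  of \<open>(v^2 + S)^q\<close>. Positivity of \<open>2 * q - 1\<close> is the condition
  \<open>p > 1\<close>.\<close>

lemma Im_mean_le_small:
  assumes q: "1 / 2 < q" "q \<le> 1" and x: "x < 0"
  shows "integral {0..2 * pi} (\<lambda>y. \<bar>Im (f (exp (Complex x y)))\<bar> powr (2 * q))
    \<le> (B + 1) / (2 * q - 1) * integral {0..2 * pi} (\<lambda>y. S (exp (Complex x y)) powr q)"
proof -
  define M where "M = (B + 1) / (2 * q - 1)"
  have M: "1 \<le> M" "M * (2 * q - 1) = B + 1"
    using q B_nonneg by (simp_all add: M_def field_simps)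
  have "0 \<le> integral {0..2 * pi}
      (\<lambda>y. M * T 0 1 (exp (Complex x y)) powr q - 1 * T 1 1 (exp (Complex x y)) powr q)"
  proof (rule mean_nonneg)
    fix x y :: real
    assume x: "x < 0"
    note bounds = powr_laplacian_bounds(3,4)[OF T_pos _ T_gradient, folded lap_def]
    have "1 * lap q 1 1 x y \<le> 2 * q * ((1 * E x y + 1 * D x y) * T 1 1 (exp (Complex x y)) powr (q - 1))"
      using bounds(2)[of 1 1 x y q] q by simp
    \<comment> \<open>Now \<open>q - 1\<close> is at most 0, so passing from \<open>T 1 1\<close>
      down to the smaller base \<open>S\<close> increases the power.\<close>
    also have "\<dots> \<le> 2 * q * ((B + 1) * D x y * T 0 1 (exp (Complex x y)) powr (q - 1))"
    proof (intro mult_left_mono mult_mono powr_mono2')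
      show "1 * E x y + 1 * D x y \<le> (B + 1) * D x y"
        using E_le[OF x, of y] by (simp add: algebra_simps)
    qed (use q B_nonneg D_nonneg T_pos[of 0 1 "exp (Complex x y)"] in \<open>auto simp: T_def\<close>)
    also have "\<dots> = M * (2 * q * (2 * q - 1) * ((0 * E x y + 1 * D x y) * T 0 1 (exp (Complex x y)) powr (q - 1)))"
      unfolding M(2)[symmetric] by simp
    also have "\<dots> \<le> M * lap q 0 1 x y"
      using bounds(1)[of 0 1 x y q] q M(1) by (intro mult_left_mono) auto
    finally show "1 * lap q 1 1 x y \<le> M * lap q 0 1 x y" .
  qed (use M x in auto)
  also have "\<dots> \<le> integral {0..2 * pi}
      (\<lambda>y. M * S (exp (Complex x y)) powr q - \<bar>Im (f (exp (Complex x y)))\<bar> powr (2 * q))"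
  proof (rule integral_le)
    fix y :: real
    define z where "z = exp (Complex x y)"
    have V: "\<bar>Im (f z)\<bar> powr (2 * q) = (Im (f z))\<^sup>2 powr q"
      by (rule abs_powr_double)
    have "(Im (f z))\<^sup>2 powr q \<le> T 1 1 z powr q"
      using q S_pos[of z] by (intro powr_mono2) (auto simp: T_def)
    then show "M * T 0 1 (exp (Complex x y)) powr q - 1 * T 1 1 (exp (Complex x y)) powr q
      \<le> M * S (exp (Complex x y)) powr q - \<bar>Im (f (exp (Complex x y)))\<bar> powr (2 * q)"
      unfolding z_def[symmetric] V by (simp add: T_def)
  qed (use x q in \<open>auto intro!: integrable_diff integrable_on_mult_right powr_T_S_integrable powr_Im_Re_integrable\<close>)
  also have "\<dots> = M * integral {0..2 * pi} (\<lambda>y. S (exp (Complex x y)) powr q)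
      - integral {0..2 * pi} (\<lambda>y. \<bar>Im (f (exp (Complex x y)))\<bar> powr (2 * q))"
    using x q by (simp add: integral_diff powr_T_S_integrable powr_Im_Re_integrable integrable_on_mult_right)
  finally show ?thesis by (simp add: M_def)
qed

end

text \<open>\<open>C\<close> is fixed before \<open>f\<close> and \<open>k\<close>, hence depends on
  \<open>p\<close> and \<open>B\<close> alone; this is what keeps the final constants independent of
  \<open>K'\<close>.\<close>

lemma Im_mean_le:
  fixes p B :: real
  assumes p: "1 < p" and B: "0 \<le> B"
  obtains C where "0 \<le> C"
    "\<And>f k x. gradient_dominated f k B \<Longrightarrow> x < 0 \<Longrightarrow>
      integral {0..2 * pi} (\<lambda>y. \<bar>Im (f (exp (Complex x y)))\<bar> powr p)
        \<le> C * integral {0..2 * pi} (\<lambda>y. gradient_dominated.S f k (exp (Complex x y)) powr (p / 2))"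
proof (cases "2 \<le> p")
  case True
  then have "0 < p / 2" "0 < 2 * (2 * (p / 2) - 1) * (B + 1)"
    using B by (auto intro!: mult_pos_pos)
  then obtain C where C: "0 \<le> C"
    "\<And>s t. 0 < s \<Longrightarrow> 0 \<le> t \<Longrightarrow>
      (t + 2 * (2 * (p / 2) - 1) * (B + 1) * s) powr (p / 2) \<le> 3 / 2 * t powr (p / 2) + C * s powr (p / 2)"
    by (rule powr_split) blast
  show ?thesis
    using gradient_dominated.Im_mean_le_large[OF _ _ _ C(1), of _ _ B "p / 2"] C True
    by (intro that[of "2 * C"]) auto
next
  case False
  then show ?thesis
    using gradient_dominated.Im_mean_le_small[of _ _ B "p / 2"] p B
    by (intro that[of "(B + 1) / (2 * (p / 2) - 1)"]) auto
qed

section \<open>Harmonic Hardy spaces\<close>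

text \<open>\<open>g\<close> has to agree with \<open>L\<close> after \<open>f\<close> on
  \<open>S\<close> only. The lemma can therefore be applied again to the partial derivatives of
  \<open>g\<close>, which are known only there.\<close>

lemma C1_on_bounded_linear:
  assumes L: "bounded_linear L" and C1: "C1_on S f" and "open S" and g: "\<And>z. z \<in> S \<Longrightarrow> g z = L (f z)"
  shows "C1_on S g" and "\<And>z. z \<in> S \<Longrightarrow> partial_x g z = L (partial_x f z)"
    and "\<And>z. z \<in> S \<Longrightarrow> partial_y g z = L (partial_y f z)"
proof -
  have line: "((\<lambda>t::real. g (z + c * of_real t)) has_vector_derivative L D) (at 0)"
    if "z \<in> S" "((\<lambda>t::real. f (z + c * of_real t)) has_vector_derivative D) (at 0)" for c D z
  proof (rule has_vector_derivative_transform_within_open)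
    show "((\<lambda>t::real. L (f (z + c * of_real t))) has_vector_derivative L D) (at 0)"
      by (rule bounded_linear.has_vector_derivative[OF L that(2)])
    show "open ((\<lambda>t::real. z + c * of_real t) -` S)"
      by (intro open_vimage \<open>open S\<close> continuous_intros)
  qed (use that g in auto)
  have x: "((\<lambda>t::real. g (z + of_real t)) has_vector_derivative L (partial_x f z)) (at 0)" if "z \<in> S" for z
    using line[OF that, of 1] C1 that by (simp add: C1_on_def partial_x_def vector_derivative_works)
  have y: "((\<lambda>t::real. g (z + \<i> * of_real t)) has_vector_derivative L (partial_y f z)) (at 0)" if "z \<in> S" for z
    using line[OF that, of \<i>] C1 that by (simp add: C1_on_def partial_y_def vector_derivative_works)
  show px: "partial_x g z = L (partial_x f z)" if "z \<in> S" for z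
    unfolding partial_x_def[of g] by (rule vector_derivative_at[OF x[OF that]])
  show py: "partial_y g z = L (partial_y f z)" if "z \<in> S" for z
    unfolding partial_y_def[of g] by (rule vector_derivative_at[OF y[OF that]])
  have "continuous_on S (\<lambda>z. L (partial_x f z))" "continuous_on S (\<lambda>z. L (partial_y f z))"
    using C1 by (auto simp: C1_on_def intro!: bounded_linear.continuous_on[OF L])
  then show "C1_on S g"
    using x y px py unfolding C1_on_def
    by (auto intro: differentiableI_vector cong: continuous_on_cong)
qed

lemma complex_harmonic_on_bounded_linear:
  assumes L: "bounded_linear L" and f: "complex_harmonic_on S f"
  shows "complex_harmonic_on S (\<lambda>z. L (f z))"
proof -
  have S: "open S" and C1: "C1_on S f" "C1_on S (partial_x f)" "C1_on S (partial_y f)"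
    using f by (auto simp: complex_harmonic_on_def C2_on_def)
  note 0 = C1_on_bounded_linear[OF L C1(1) S refl]
  note x = C1_on_bounded_linear[OF L C1(2) S 0(2)]
  note y = C1_on_bounded_linear[OF L C1(3) S 0(3)]
  have "partial_x (partial_x (\<lambda>z. L (f z))) z + partial_y (partial_y (\<lambda>z. L (f z))) z = 0" if "z \<in> S" for z
  proof -
    have "L (partial_x (partial_x f) z + partial_y (partial_y f) z) = 0"
      using f that linear_simps(3)[OF L] by (simp add: complex_harmonic_on_def)
    then show ?thesis
      using that by (simp add: x(2) y(3) linear_simps(1)[OF L])
  qed
  then show ?thesis
    using S 0(1) x(1) y(1) by (simp add: complex_harmonic_on_def C2_on_def)
qed

section \<open>From circle integrals to integral means\<close>

lemma integral_mean_eq: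
  assumes "0 < r"
  shows "integral_mean p r g = (1 / (2 * pi) * integral {0..2 * pi} (\<lambda>y. cmod (g (exp (Complex (ln r) y))) powr p)) powr (1 / p)"
  using assms by (simp add: integral_mean_def exp_Complex)

text \<open>In the disk \<open>S\<close> is at most \<open>u^2 + 2 * k\<close>. Sums are twice
  replaced by doubled maxima, which commute with powers of any positive exponent; hence the factors
  \<open>2 powr (p / 2)\<close> and 2. The root \<open>sqrt (2 * k)\<close> is
  \<open>b powr (1 / p)\<close>.\<close>

lemma (in gradient_dominated) integral_mean_Im_le:
  assumes p: "1 < p" and C: "0 \<le> C" and r: "r \<in> {0<..<1}"
    and le: "\<And>x. x < 0 \<Longrightarrow> integral {0..2 * pi} (\<lambda>y. \<bar>Im (f (exp (Complex x y)))\<bar> powr p)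
      \<le> C * integral {0..2 * pi} (\<lambda>y. S (exp (Complex x y)) powr (p / 2))"
  shows "integral_mean p r (\<lambda>z. of_real (Im (f z)))
    \<le> (2 * C * 2 powr (p / 2)) powr (1 / p) * (integral_mean p r (\<lambda>z. of_real (Re (f z))) + sqrt (2 * k))"
proof -
  define x where "x = ln r"
  have x: "x < 0" using r by (simp add: x_def)
  define a where "a = 1 / (2 * pi) * integral {0..2 * pi} (\<lambda>y. \<bar>Re (f (exp (Complex x y)))\<bar> powr p)"
  define b where "b = (2 * k) powr (p / 2)"
  have "0 \<le> integral {0..2 * pi} (\<lambda>y. \<bar>Re (f (exp (Complex x y)))\<bar> powr p)"
    using x p by (intro integral_nonneg powr_Im_Re_integrable) auto
  then have a: "0 \<le> a" and b: "0 \<le> b"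
    by (simp_all add: a_def b_def)
  have "S z powr (p / 2) \<le> 2 powr (p / 2) * (\<bar>Re (f z)\<bar> powr p + b)" if "z \<in> unit_disk" for z
  proof -
    have R: "\<bar>Re (f z)\<bar> powr p = (Re (f z))\<^sup>2 powr (p / 2)"
      using abs_powr_double[of "Re (f z)" "p / 2"] by simp
    have "(cmod z)\<^sup>2 \<le> 1" using that by (simp add: power_le_one)
    then have "S z \<le> (Re (f z))\<^sup>2 + k * (1 + 1)"
      unfolding S_def using k_pos by (intro add_left_mono mult_left_mono) auto
    then have "S z \<le> 2 * max ((Re (f z))\<^sup>2) (2 * k)" by simp
    then have "S z powr (p / 2) \<le> (2 * max ((Re (f z))\<^sup>2) (2 * k)) powr (p / 2)"
      using p S_pos[of z] by (intro powr_mono2) auto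
    also have "\<dots> = 2 powr (p / 2) * max ((Re (f z))\<^sup>2) (2 * k) powr (p / 2)"
      using k_pos by (simp add: powr_mult)
    also have "\<dots> \<le> 2 powr (p / 2) * (\<bar>Re (f z)\<bar> powr p + b)"
      unfolding R b_def by (intro mult_left_mono) (auto simp: max_def)
    finally show ?thesis .
  qed
  then have "integral {0..2 * pi} (\<lambda>y. S (exp (Complex x y)) powr (p / 2))
      \<le> integral {0..2 * pi} (\<lambda>y. 2 powr (p / 2) * (\<bar>Re (f (exp (Complex x y)))\<bar> powr p + b))"
    using x p by (intro integral_le powr_T_S_integrable integrable_on_mult_right integrable_add powr_Im_Re_integrable) auto
  also have "\<dots> = 2 powr (p / 2) * (integral {0..2 * pi} (\<lambda>y. \<bar>Re (f (exp (Complex x y)))\<bar> powr p) + 2 * pi * b)"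
    using integral_add[OF powr_Im_Re_integrable(2)[of x p] integrable_const_ivl[of b 0 "2 * pi"]] x p by simp
  also have "\<dots> = 2 powr (p / 2) * (2 * pi * (a + b))"
    by (simp add: a_def distrib_left)
  finally have "integral {0..2 * pi} (\<lambda>y. S (exp (Complex x y)) powr (p / 2))
      \<le> 2 powr (p / 2) * (2 * pi * (a + b))" .
  from order_trans[OF le[OF x] mult_left_mono[OF this C]]
  have "1 / (2 * pi) * integral {0..2 * pi} (\<lambda>y. \<bar>Im (f (exp (Complex x y)))\<bar> powr p)
      \<le> 1 / (2 * pi) * (C * (2 powr (p / 2) * (2 * pi * (a + b))))"
    by (rule mult_left_mono) simp
  also have "\<dots> = C * 2 powr (p / 2) * (a + b)" by simp
  also have "\<dots> \<le> C * 2 powr (p / 2) * (2 * max a b)"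
    using C by (intro mult_left_mono) auto
  finally have mean: "1 / (2 * pi) * integral {0..2 * pi} (\<lambda>y. \<bar>Im (f (exp (Complex x y)))\<bar> powr p)
      \<le> C * 2 powr (p / 2) * (2 * max a b)" .
  have "0 \<le> integral {0..2 * pi} (\<lambda>y. \<bar>Im (f (exp (Complex x y)))\<bar> powr p)"
    using x p by (intro integral_nonneg powr_Im_Re_integrable) auto
  then have "(1 / (2 * pi) * integral {0..2 * pi} (\<lambda>y. \<bar>Im (f (exp (Complex x y)))\<bar> powr p)) powr (1 / p)
      \<le> (C * 2 powr (p / 2) * (2 * max a b)) powr (1 / p)"
    using p by (intro powr_mono2 mean) simp_all
  moreover have "integral_mean p r (\<lambda>z. of_real (Im (f z)))
      = (1 / (2 * pi) * integral {0..2 * pi} (\<lambda>y. \<bar>Im (f (exp (Complex x y)))\<bar> powr p)) powr (1 / p)"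
    using r by (subst integral_mean_eq) (auto simp: x_def)
  ultimately have "integral_mean p r (\<lambda>z. of_real (Im (f z))) \<le> (C * 2 powr (p / 2) * (2 * max a b)) powr (1 / p)"
    by (simp only:)
  also have "C * 2 powr (p / 2) * (2 * max a b) = 2 * C * 2 powr (p / 2) * max a b"
    by simp
  also have "\<dots> powr (1 / p) = (2 * C * 2 powr (p / 2)) powr (1 / p) * max a b powr (1 / p)"
    by (rule powr_mult)
  also have "\<dots> \<le> (2 * C * 2 powr (p / 2)) powr (1 / p) * (a powr (1 / p) + b powr (1 / p))"
    by (intro mult_left_mono) (auto simp: max_def)
  also have "b powr (1 / p) = sqrt (2 * k)"
    using p k_pos by (simp add: b_def powr_powr powr_half_sqrt)
  also have "a powr (1 / p) = integral_mean p r (\<lambda>z. of_real (Re (f z)))"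
    using r by (subst integral_mean_eq) (auto simp: a_def x_def)
  finally show ?thesis .
qed

text \<open>Since \<open>K\<close> is at least 1, the additive \<open>4 * K'\<close> is at most
  \<open>4 * K^2 * 2 * (K' + \<epsilon>)\<close>. The shift by \<open>\<epsilon>\<close> keeps
  \<open>k\<close> positive when \<open>K'\<close> is 0.\<close>

lemma harmonic_quasiregular_gradient_dominated:
  assumes "harmonic_quasiregular K K' f" "1 \<le> K" "0 \<le> K'" "0 < \<epsilon>" "Im (f 0) = 0"
  shows "gradient_dominated f (K' + \<epsilon>) (4 * K\<^sup>2)"
proof
  fix z :: complex
  assume "z \<in> unit_disk"
  define g where "g = (Re (partial_x f z))\<^sup>2 + (Re (partial_y f z))\<^sup>2"
  have "(Im (partial_x f z))\<^sup>2 + (Im (partial_y f z))\<^sup>2 \<le> 4 * K\<^sup>2 * g + 4 * (1 * K')"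
    using harmonic_quasiregular_gradient[OF assms(1) \<open>z \<in> unit_disk\<close>] by (simp add: g_def)
  also have "\<dots> \<le> 4 * K\<^sup>2 * g + 4 * (K\<^sup>2 * (2 * (K' + \<epsilon>)))"
    using assms one_le_power[of K 2] by (intro add_left_mono mult_left_mono mult_mono) auto
  finally show "(Im (partial_x f z))\<^sup>2 + (Im (partial_y f z))\<^sup>2
      \<le> 4 * K\<^sup>2 * ((Re (partial_x f z))\<^sup>2 + (Re (partial_y f z))\<^sup>2 + 2 * (K' + \<epsilon>))"
    by (simp add: g_def algebra_simps)
qed (use assms in \<open>auto simp: harmonic_quasiregular_def\<close>)

theorem theorem2p1:
  fixes K p :: real
  assumes "1 \<le> K" and "1 < p"
  shows "\<exists>C1 C2 :: real.
    \<forall>(K' :: real) (f :: complex \<Rightarrow> complex) (u :: complex \<Rightarrow> complex) (v :: complex \<Rightarrow> complex).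
      0 \<le> K' \<and> harmonic_quasiregular K K' f
      \<and> u = (\<lambda>z. complex_of_real (Re (f z))) \<and> v = (\<lambda>z. complex_of_real (Im (f z)))
      \<and> v 0 = 0 \<and> u \<in> harmonic_hardy p
      \<longrightarrow> v \<in> harmonic_hardy p
        \<and> (\<forall>r\<in>{0..<1}. integral_mean p r v \<le> C1 * integral_mean p r u + C2 * sqrt K')"
proof -
  obtain C where C: "0 \<le> C"
    "\<And>f k x. gradient_dominated f k (4 * K\<^sup>2) \<Longrightarrow> x < 0 \<Longrightarrow>
      integral {0..2 * pi} (\<lambda>y. \<bar>Im (f (exp (Complex x y)))\<bar> powr p)
        \<le> C * integral {0..2 * pi} (\<lambda>y. gradient_dominated.S f k (exp (Complex x y)) powr (p / 2))"
    using Im_mean_le[OF \<open>1 < p\<close>, of "4 * K\<^sup>2"] by auto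
  define A where "A = (2 * C * 2 powr (p / 2)) powr (1 / p)"
  have A: "0 \<le> A" by (simp add: A_def)
  show ?thesis
  \<comment> \<open>The factor \<open>sqrt 2\<close> comes from \<open>sqrt (2 * k)\<close> with
    \<open>k\<close> tending to \<open>K'\<close>.\<close>
  proof (rule exI[of _ A], rule exI[of _ "A * sqrt 2"], intro allI impI, elim conjE)
    fix K' :: real and f u v :: "complex \<Rightarrow> complex"
    assume K': "0 \<le> K'" and f: "harmonic_quasiregular K K' f"
      and u: "u = (\<lambda>z. complex_of_real (Re (f z)))" and v: "v = (\<lambda>z. complex_of_real (Im (f z)))"
      and v0: "v 0 = 0" and u_hardy: "u \<in> harmonic_hardy p"
    have f0: "Im (f 0) = 0" using v0 by (simp add: v)
    have le: "integral_mean p r v \<le> A * integral_mean p r u + A * sqrt 2 * sqrt K'" if r: "r \<in> {0..<1}" for r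
    proof (cases "r = 0")
      \<comment> \<open>Logarithmic coordinates miss the centre; there the mean of \<open>v\<close>
        is 0 because \<open>v 0 = 0\<close>.\<close>
      case True
      then have "integral_mean p r v = 0"
        using f0 \<open>1 < p\<close> by (simp add: integral_mean_def v)
      moreover have "0 \<le> integral_mean p r u" by (simp add: integral_mean_def)
      ultimately show ?thesis using A K' by simp
    next
      case False
      have "integral_mean p r v \<le> A * (integral_mean p r u + sqrt (2 * (K' + \<epsilon>)))" if "0 < \<epsilon>" for \<epsilon>
      proof -
        have gd: "gradient_dominated f (K' + \<epsilon>) (4 * K\<^sup>2)"
          using f \<open>1 \<le> K\<close> K' that f0 by (rule harmonic_quasiregular_gradient_dominated)
        show ?thesis
          using gradient_dominated.integral_mean_Im_le[OF gd \<open>1 < p\<close> C(1) _ C(2)[OF gd]] r False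
          by (simp add: A_def u v)
      qed
      \<comment> \<open>\<open>A\<close> does not depend on \<open>\<epsilon>\<close>, so the bound
        survives the limit as \<open>\<epsilon>\<close> decreases to 0.\<close>
      then have "\<forall>\<^sub>F \<epsilon> in at_right 0. integral_mean p r v \<le> A * (integral_mean p r u + sqrt (2 * (K' + \<epsilon>)))"
        by (auto simp: eventually_at_filter)
      moreover have "((\<lambda>\<epsilon>. A * (integral_mean p r u + sqrt (2 * (K' + \<epsilon>)))) \<longlongrightarrow>
          A * (integral_mean p r u + sqrt (2 * (K' + 0)))) (at_right 0)"
        by (intro tendsto_intros)
      ultimately have "integral_mean p r v \<le> A * (integral_mean p r u + sqrt (2 * (K' + 0)))"
        by (intro tendsto_lowerbound[where F = "at_right (0::real)"]) auto
      then show ?thesis by (simp add: real_sqrt_mult algebra_simps)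
    qed
    have "bounded_linear (\<lambda>z. complex_of_real (Im z))"
      by (intro bounded_linear_compose[OF bounded_linear_of_real] bounded_linear_Im)
    from complex_harmonic_on_bounded_linear[OF this] have "complex_harmonic_on unit_disk v"
      unfolding v using f by (simp add: harmonic_quasiregular_def)
    moreover obtain m where m: "integral_mean p r u \<le> m" if "r \<in> {0..<1}" for r
      using u_hardy by (fastforce simp: harmonic_hardy_def bdd_above_def)
    have "integral_mean p r v \<le> A * m + A * sqrt 2 * sqrt K'" if "r \<in> {0..<1}" for r
      by (intro order_trans[OF le[OF that]] add_right_mono mult_left_mono A m that)
    then have "bdd_above ((\<lambda>r. integral_mean p r v) ` {0..<1})"
      by (intro bdd_aboveI[of _ "A * m + A * sqrt 2 * sqrt K'"]) auto
    ultimately show "v \<in> harmonic_hardy p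
        \<and> (\<forall>r\<in>{0..<1}. integral_mean p r v \<le> A * integral_mean p r u + A * sqrt 2 * sqrt K')"
      using le by (simp add: harmonic_hardy_def)
  qed
qed

end
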